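(* Let $(B(t))_{t\ge 0}$ be a standard Brownian motion, let $S(t)=\max_{0\le s\le t}B(s)$ be its supremum process, let $\mathcal{A}=\int_0^1 S(t)\,dt$, and let $\psi(s)=\mathbb{E}\, e^{-s\mathcal{A}}$ be the Laplace transform of $\mathcal{A}$. Then for all $\alpha,\lambda>0$, \[ \int_0^\infty \psi\bigl(\alpha s^{3/2}\bigr)e^{-\lambda s}\,ds=\int_0^\infty\Bigl(1+\frac{3\alpha s}{2\sqrt{2\lambda}}\Bigr)^{-2/3}e^{-\lambda s}\,ds . \] *)

theory Defs
  imports "HOL-Probability.Probability"
begin

definition standard_brownian_motion :: "'a measure \<Rightarrow> (real \<Rightarrow> 'a \<Rightarrow> real) \<Rightarrow> bool" where
  "standard_brownian_motion M B \<longleftrightarrow>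
     prob_space M \<and>
     (\<forall>\<omega>\<in>space M. B 0 \<omega> = 0) \<and>
     (\<forall>\<omega>\<in>space M. continuous_on {0..} (\<lambda>t. B t \<omega>)) \<and>
     (\<forall>s t. 0 \<le> s \<and> s < t \<longrightarrow>
        distributed M lborel (\<lambda>\<omega>. B t \<omega> - B s \<omega>) (\<lambda>x. ennreal (normal_density 0 (sqrt (t - s)) x))) \<and>
     (\<forall>(ts :: nat \<Rightarrow> real) n. 0 \<le> ts 0 \<and> strict_mono ts \<longrightarrow>
        prob_space.indep_vars M (\<lambda>_. borel) (\<lambda>i \<omega>. B (ts (Suc i)) \<omega> - B (ts i) \<omega>) {..<n})"

definition sup_process :: "(real \<Rightarrow> 'a \<Rightarrow> real) \<Rightarrow> real \<Rightarrow> 'a \<Rightarrow> real" where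
  "sup_process B t \<omega> = Sup ((\<lambda>s. B s \<omega>) ` {0..t})"

definition sup_area :: "(real \<Rightarrow> 'a \<Rightarrow> real) \<Rightarrow> 'a \<Rightarrow> real" where
  "sup_area B \<omega> = (LBINT t=0..1. sup_process B t \<omega>)"

end

theory Submission
  imports Defs "HOL-Real_Asymp.Real_Asymp"
begin

text \<open>
  Both sides equal \<open>u(l) = E \<integral> exp (- \<integral>\<^sub>0\<^sup>t (l + a S\<^sub>r) dr) dt\<close>; on the left this is Brownian scaling.
  Write \<open>\<kappa>(\<mu>) = sqrt (2 \<mu>)\<close>. The expected remaining discounted time, as a function of the current
  rate \<open>\<mu> = l + a S\<close> and of the gap \<open>d = S - B\<close>, solves \<open>v\<^sub>d\<^sub>d / 2 - \<mu> v + 1 = 0\<close> with the boundary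
  condition \<open>a v\<^sub>\<mu> + v\<^sub>d = 0\<close> at \<open>d = 0\<close>. Hence \<open>v = 1 / \<mu> + (u(\<mu>) - 1 / \<mu>) exp (- \<kappa>(\<mu>) d)\<close> with
  \<open>a u' = \<kappa> (u - 1 / \<mu>)\<close>, and the right-hand side of the theorem is the bounded solution of this
  equation.

  No stochastic calculus is needed. The walk obtained by sampling \<open>B\<close> with time step \<open>h\<close>
  satisfies the dynamic programming equation for \<open>v\<close> up to the expected square of the increment of its
  maximum and a term of order \<open>h\<^sup>2\<close>. The squares sum to a quantity that vanishes with \<open>h\<close>, because
  the maximum has bounded expectation and the steps have small fourth moments. So the expected
  discounted time of the walk tends to \<open>u(l)\<close>.
\<close>

section \<open>The solution of the boundary equation\<close>

text \<open>The condition \<open>a v_mu + v_d = 0\<close> is the coefficient of dS in dv: the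
  maximum moves only at gap zero, where a rise dS raises the rate by a dS and enters the gap as dS.
  The resulting equation a u' = kappa (u - 1/mu) is linear, with integrating factor exp (- mu^(3/2)
  / b) for b = 3a / (2 sqrt 2); hence the variable w = mu^(3/2). Other solutions differ by a
  multiple of exp (w / b), so integrating down from infinity selects the bounded one. In discrete
  time the maximum jumps. The boundary condition cancels only the first-order effect of a jump,
  which is why squared jumps are the main error. The passage to Brownian motion works with laws for
  a fixed number of steps. The first k steps of any walk with independent standard normal steps have
  the same law, so they may be replaced by the normalised increments of B on the mesh 1/k of [0,1].
  The number of steps up to a fixed positive time grows as the time step shrinks, so this mesh
  refines and the area converges along each path.\<close>

text \<open>With \<open>u = l s\<close> and \<open>w = l powr (3/2)\<close> the right-hand side of the theorem takes this form, in which
  the variable \<open>w\<close> only shifts the range of integration after a further substitution.\<close>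

definition tail_fn :: "real \<Rightarrow> real \<Rightarrow> real" where
  "tail_fn b w = (LBINT u:{0..}. (w + b * u) powr (-2/3) * exp (- u))"

lemma has_bochner_integral_power_exp:
  "has_bochner_integral lborel (\<lambda>u::real. indicator {0..} u *\<^sub>R (u ^ k * exp (- u))) (fact k)"
proof (rule has_bochner_integral_nn_integral)
  have "(\<integral>\<^sup>+ u. ennreal (indicator {0..} u *\<^sub>R (u ^ k * exp (- u))) \<partial>lborel)
      = (\<integral>\<^sup>+ u. ennreal (u ^ k * exp (- u)) * indicator {0..} u \<partial>lborel)"
    by (intro nn_integral_cong) (auto simp: indicator_def)
  also have "\<dots> = ennreal (fact k)"
    using nn_intergal_power_times_exp_Ici[of k] by simp
  finally show "(\<integral>\<^sup>+ u. ennreal (indicator {0..} u *\<^sub>R (u ^ k * exp (- u))) \<partial>lborel) = ennreal (fact k)" .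
qed (auto simp: indicator_def)

text \<open>The tangent line at 0 lies below the convex function; here this follows from ln (1 + t)
  <= t and exp x >= 1 + x.\<close>

lemma one_plus_powr_ge:
  fixes t :: real
  assumes "t \<ge> 0"
  shows "(1 + t) powr (-2/3) \<ge> 1 - 2/3 * t"
proof -
  have "1 - 2/3 * t \<le> 1 + (-2/3) * ln (1 + t)" using ln_add_one_self_le_self[OF assms] by simp
  also have "\<dots> \<le> exp ((-2/3) * ln (1 + t))" by (rule exp_ge_add_one_self)
  also have "\<dots> = (1 + t) powr (-2/3)" using assms by (simp add: powr_def)
  finally show ?thesis .
qed

lemma shifted_powr_bounds:
  fixes w b u :: real
  assumes "w > 0" "b > 0" "u \<ge> 0"
  shows "(w + b * u) powr (-2/3) \<le> w powr (-2/3)"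
    and "(w + b * u) powr (-2/3) \<ge> w powr (-2/3) - 2 * b / 3 * w powr (-5/3) * u"
proof -
  show "(w + b * u) powr (-2/3) \<le> w powr (-2/3)"
    using assms by (intro powr_mono2') auto
  have "w powr (-2/3) - 2 * b / 3 * w powr (-5/3) * u = w powr (-2/3) * (1 - 2/3 * (b * u / w))"
  proof -
    have "w powr (-5/3) = w powr (-2/3) / w"
      using assms powr_diff[of w "-2/3" 1] by simp
    then show ?thesis using assms by (simp only:) (simp add: algebra_simps)
  qed
  also have "\<dots> \<le> w powr (-2/3) * (1 + b * u / w) powr (-2/3)"
    using assms by (intro mult_left_mono one_plus_powr_ge) auto
  also have "\<dots> = (w * (1 + b * u / w)) powr (-2/3)"
    using assms by (subst powr_mult) auto
  also have "w * (1 + b * u / w) = w + b * u" using assms by (simp add: field_simps)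
  finally show "(w + b * u) powr (-2/3) \<ge> w powr (-2/3) - 2 * b / 3 * w powr (-5/3) * u" .
qed

lemma tail_fn_integrable:
  assumes "w > 0" "b > 0"
  shows "set_integrable lborel {0..} (\<lambda>u::real. (w + b * u) powr (-2/3) * exp (- u))"
  unfolding set_integrable_def
proof (rule Bochner_Integration.integrable_bound)
  show "integrable lborel (\<lambda>u::real. w powr (-2/3) * (indicator {0..} u *\<^sub>R (u ^ 0 * exp (- u))))"
    by (intro integrable_mult_right has_bochner_integral_power_exp[THEN integrable.intros])
  show "AE u in lborel. norm (indicator {0..} u *\<^sub>R ((w + b * u) powr (-2/3) * exp (- u)))
      \<le> norm (w powr (-2/3) * (indicator {0..} u *\<^sub>R (u ^ 0 * exp (- u))))"
    using assms by (auto simp: indicator_def abs_mult intro!: mult_right_mono shifted_powr_bounds(1)[simplified])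
qed auto

text \<open>The pointwise bounds are integrated against exp (- u), which has mass and mean 1. At w =
  mu^(3/2) the leading term is 1/mu and the correction is of order mu^(-5/2). This decay of
  \<open>boundary_coeff\<close> makes all later constants uniform in mu.\<close>

lemma tail_fn_bounds:
  assumes "w > 0" "b > 0"
  shows "tail_fn b w \<le> w powr (-2/3)"
    and "tail_fn b w \<ge> w powr (-2/3) - 2 * b / 3 * w powr (-5/3)"
proof -
  note P = has_bochner_integral_power_exp
  have P0: "integrable lborel (\<lambda>u::real. indicator {0..} u *\<^sub>R exp (- u))"
     "(\<integral>u. indicator {0..} u *\<^sub>R exp (- u) \<partial>lborel) = (1::real)"
    using P[of 0] by (auto simp: has_bochner_integral_iff)
  have P1: "integrable lborel (\<lambda>u::real. indicator {0..} u *\<^sub>R (u * exp (- u)))"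
     "(\<integral>u. indicator {0..} u *\<^sub>R (u * exp (- u)) \<partial>lborel) = (1::real)"
    using P[of 1] by (auto simp: has_bochner_integral_iff)
  have "tail_fn b w \<le> (LBINT u. w powr (-2/3) * (indicator {0..} u *\<^sub>R exp (- u)))"
    unfolding tail_fn_def set_lebesgue_integral_def
    using assms P0 tail_fn_integrable[OF assms, unfolded set_integrable_def]
    by (intro integral_mono) (auto simp: indicator_def intro!: shifted_powr_bounds(1)[simplified])
  also have "\<dots> = w powr (-2/3)" using P0 by simp
  finally show "tail_fn b w \<le> w powr (-2/3)" .
  have "w powr (-2/3) - 2 * b / 3 * w powr (-5/3) =
     (LBINT u. w powr (-2/3) * (indicator {0..} u *\<^sub>R exp (- u)) - 2 * b / 3 * w powr (-5/3) * (indicator {0..} u *\<^sub>R (u * exp (- u))))"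
    using P0 P1 by simp
  also have "\<dots> \<le> tail_fn b w"
    unfolding tail_fn_def set_lebesgue_integral_def
  proof (intro integral_mono)
    fix u :: real
    have "(w powr (-2/3) - 2 * b / 3 * w powr (-5/3) * u) * exp (- u) \<le> (w + b * u) powr (-2/3) * exp (- u)" if "u \<ge> 0"
      using that assms by (intro mult_right_mono shifted_powr_bounds) auto
    then show "w powr (-2/3) * (indicator {0..} u *\<^sub>R exp (- u)) - 2 * b / 3 * w powr (-5/3) * (indicator {0..} u *\<^sub>R (u * exp (- u)))
      \<le> indicator {0..} u *\<^sub>R ((w + b * u) powr (-2/3) * exp (- u))"
      by (auto simp: indicator_def algebra_simps)
  qed (use P0 P1 tail_fn_integrable[OF assms, unfolded set_integrable_def] in auto)
  finally show "tail_fn b w \<ge> w powr (-2/3) - 2 * b / 3 * w powr (-5/3)" .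
qed

text \<open>The substitution r = w + b u moves w into the lower limit, so that the fundamental
  theorem of calculus gives the derivative in w.\<close>

lemma tail_fn_shift:
  assumes "w > 0" "b > 0"
  shows "set_integrable lborel {w..} (\<lambda>r. r powr (-2/3) * exp (- r / b))"
    and "tail_fn b w = exp (w / b) / b * (LBINT r:{w..}. r powr (-2/3) * exp (- r / b))"
proof -
  have eq: "indicator {w..} (w + b * u) *\<^sub>R ((w + b * u) powr (-2/3) * exp (- (w + b * u) / b))
     = exp (- w / b) * (indicator {0..} u *\<^sub>R ((w + b * u) powr (-2/3) * exp (- u)))" for u :: real
  proof -
    have "exp (- (w + b * u) / b) = exp (- w / b) * exp (- u)"
      using assms by (simp add: field_simps flip: exp_add)
    then show ?thesis using assms by (auto simp: indicator_def zero_le_mult_iff)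
  qed
  have "integrable lborel (\<lambda>u. indicator {w..} (w + b * u) *\<^sub>R ((w + b * u) powr (-2/3) * exp (- (w + b * u) / b)))"
    unfolding eq using tail_fn_integrable[OF assms, unfolded set_integrable_def] by simp
  then show "set_integrable lborel {w..} (\<lambda>r. r powr (-2/3) * exp (- r / b))"
    using assms unfolding set_integrable_def by (subst (asm) lborel_integrable_real_affine_iff) auto
  have "(LBINT r:{w..}. r powr (-2/3) * exp (- r / b))
      = b * (LBINT u. indicator {w..} (w + b * u) *\<^sub>R ((w + b * u) powr (-2/3) * exp (- (w + b * u) / b)))"
    unfolding set_lebesgue_integral_def using assms by (subst lborel_integral_real_affine[where t=w and c=b]) auto
  also have "\<dots> = b * exp (- w / b) * tail_fn b w"
    unfolding eq tail_fn_def set_lebesgue_integral_def by simp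
  finally show "tail_fn b w = exp (w / b) / b * (LBINT r:{w..}. r powr (-2/3) * exp (- r / b))"
    using assms by (simp add: exp_minus field_simps)
qed

lemma tail_fn_deriv:
  assumes "w > 0" "b > 0"
  shows "(tail_fn b has_real_derivative (tail_fn b w - w powr (-2/3)) / b) (at w)"
proof -
  define g where "g = (\<lambda>r. r powr (-2/3) * exp (- r / b))"
  \<comment> \<open>The fixed tail from w/2 is split off, leaving a proper integral with a moving
    endpoint. The base point w/2 keeps w interior to \<open>{w/2..2*w}\<close>, so the derivative is
    two-sided.\<close>
  define K where "K = (LBINT r:{w/2..}. g r)"
  define I where "I = (\<lambda>x. integral {w/2..x} g)"
  have cont: "continuous_on {w/2..2*w} g"
    unfolding g_def using assms by (intro continuous_intros) auto
  have "(I has_real_derivative g w) (at w within {w/2..2*w})"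
    unfolding I_def using assms cont by (intro integral_has_real_derivative) auto
  then have I': "(I has_real_derivative g w) (at w)"
    using at_within_Icc_at[of "w/2" w "2*w"] assms by simp
  have eq: "tail_fn b x = exp (x / b) / b * (K - I x)" if x: "x \<in> {w/2<..<2*w}" for x
  proof -
    have "set_integrable lborel {w/2..} g" unfolding g_def using assms by (intro tail_fn_shift) auto
    moreover have "{w/2..} = {w/2..x} \<union> {x<..}" using x by auto
    ultimately have "K = (LBINT r:{w/2..x}. g r) + (LBINT r:{x<..}. g r)"
      unfolding K_def by (simp only:) (intro set_integral_Un, auto intro: set_integrable_subset)
    also have "(LBINT r:{x<..}. g r) = (LBINT r:{x..}. g r)"
      by (intro set_integral_cong_set AE_I[where N="{x}"]) (auto simp: set_borel_measurable_def g_def)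
    also have "(LBINT r:{w/2..x}. g r) = I x"
      unfolding I_def using x assms cont
      by (intro set_borel_integral_eq_integral) (auto intro!: borel_integrable_atLeastAtMost' continuous_on_subset[OF cont])
    finally have "K - I x = (LBINT r:{x..}. g r)" by linarith
    moreover have "tail_fn b x = exp (x / b) / b * (LBINT r:{x..}. g r)"
      using tail_fn_shift(2)[of x b] x assms unfolding g_def by auto
    ultimately show ?thesis by simp
  qed
  have "((\<lambda>x. exp (x / b) / b * (K - I x)) has_real_derivative
       exp (w / b) / b / b * (K - I w) + exp (w / b) / b * (0 - g w)) (at w)"
    using assms by (auto intro!: derivative_eq_intros I' simp: diff_divide_distrib add_divide_distrib algebra_simps)
  also have "exp (w / b) / b / b * (K - I w) + exp (w / b) / b * (0 - g w) = (tail_fn b w - w powr (-2/3)) / b"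
    using assms by (subst eq) (auto simp: g_def field_simps exp_minus)
  finally show ?thesis
    by (rule has_field_derivative_transform_within_open[where S="{w/2<..<2*w}"]) (use assms eq in auto)
qed

section \<open>Second-order control of the boundary equation\<close>

lemma second_order_remainder_bound:
  fixes f f' f'' :: "real \<Rightarrow> real"
  assumes y: "y \<ge> 0"
    and f: "\<And>t. 0 \<le> t \<Longrightarrow> t \<le> y \<Longrightarrow> (f has_real_derivative f' t) (at t)"
    and f': "\<And>t. 0 \<le> t \<Longrightarrow> t \<le> y \<Longrightarrow> (f' has_real_derivative f'' t) (at t)"
    and K: "\<And>t. 0 \<le> t \<Longrightarrow> t \<le> y \<Longrightarrow> \<bar>f'' t\<bar> \<le> K"
  shows "\<bar>f y - f 0 - y * f' 0\<bar> \<le> K * y\<^sup>2"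
proof (cases "y = 0")
  case False
  then have "0 < y" using y by simp
  then obtain t where t: "0 < t" "t < y" "f y - f 0 = (y - 0) * f' t"
    using MVT2[of 0 y f f'] f by auto
  then obtain s where s: "0 < s" "s < t" "f' t - f' 0 = (t - 0) * f'' s"
    using MVT2[of 0 t f' f''] f' by auto
  have "f y - f 0 - y * f' 0 = y * (f' t - f' 0)" using t by (simp add: algebra_simps)
  also have "\<dots> = y * t * f'' s" using s by simp
  also have "\<bar>\<dots>\<bar> = (y * t) * \<bar>f'' s\<bar>" using t y by (simp add: abs_mult)
  also have "\<dots> \<le> (y * y) * K"
    using t s y K[of s] by (intro mult_mono) auto
  finally show ?thesis by (simp add: power2_eq_square mult.commute)
qed simp

text \<open>This is the u(mu) of the overview. The constant b = 3a / (2 sqrt 2) is fixed by the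
  chain rule: (3/2) sqrt mu / b must equal sqrt (2 mu) / a.\<close>

definition area_fn :: "real \<Rightarrow> real \<Rightarrow> real" where
  "area_fn a \<mu> = tail_fn (3 * a / (2 * sqrt 2)) (\<mu> powr (3/2))"

text \<open>The coefficient of the decaying exponential in v, determined by v = u at gap
  zero.\<close>

definition boundary_coeff :: "real \<Rightarrow> real \<Rightarrow> real" where
  "boundary_coeff a \<mu> = area_fn a \<mu> - 1 / \<mu>"

lemma area_fn_eq:
  assumes "a > 0" "l > 0"
  shows "area_fn a l = (LBINT s:{0..}. (1 + 3 * a * s / (2 * sqrt (2 * l))) powr (-2/3) * exp (- l * s))"
proof -
  define b where "b = 3 * a / (2 * sqrt 2)"
  have "b > 0" using assms by (simp add: b_def)
  have "area_fn a l = l * (LBINT s. indicator {0..} (l * s) *\<^sub>R ((l powr (3/2) + b * (l * s)) powr (-2/3) * exp (- (l * s))))"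
    unfolding area_fn_def tail_fn_def set_lebesgue_integral_def b_def[symmetric]
    using assms by (subst lborel_integral_real_affine[where t=0 and c=l]) auto
  also have "\<dots> = (LBINT s. l * (indicator {0..} (l * s) *\<^sub>R ((l powr (3/2) + b * (l * s)) powr (-2/3) * exp (- (l * s)))))"
    by simp
  also have "\<dots> = (LBINT s:{0..}. (1 + 3 * a * s / (2 * sqrt (2 * l))) powr (-2/3) * exp (- l * s))"
    unfolding set_lebesgue_integral_def
  proof (intro Bochner_Integration.integral_cong refl)
    fix s :: real
    show "l * (indicator {0..} (l * s) *\<^sub>R ((l powr (3/2) + b * (l * s)) powr (-2/3) * exp (- (l * s))))
       = indicator {0..} s *\<^sub>R ((1 + 3 * a * s / (2 * sqrt (2 * l))) powr (-2/3) * exp (- l * s))"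
    proof (cases "s \<ge> 0")
      case True
      have l32: "l powr (3/2) = l * sqrt l"
        using assms powr_add[of l 1 "1/2"] by (simp add: powr_half_sqrt)
      have "3 * a * s / (2 * sqrt (2 * l)) = b * s / sqrt l"
        by (simp add: b_def real_sqrt_mult)
      then have "l powr (3/2) + b * (l * s) = l powr (3/2) * (1 + 3 * a * s / (2 * sqrt (2 * l)))"
        using assms unfolding l32 by (simp only:) (auto simp: field_simps)
      also have "\<dots> powr (-2/3) = (l powr (3/2)) powr (-2/3) * (1 + 3 * a * s / (2 * sqrt (2 * l))) powr (-2/3)"
        by (rule powr_mult)
      also have "(l powr (3/2)) powr (-2/3) = 1 / l"
        using assms by (simp add: powr_powr powr_minus_divide)
      finally show ?thesis using assms True by (simp add: indicator_def)
    qed (use assms in \<open>auto simp: indicator_def zero_le_mult_iff\<close>)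
  qed
  finally show ?thesis .
qed

lemma boundary_coeff_bounds:
  assumes "a > 0" "\<mu> > 0"
  shows "\<bar>boundary_coeff a \<mu>\<bar> \<le> a / sqrt 2 * \<mu> powr (-5/2)"
proof -
  define b where "b = 3 * a / (2 * sqrt 2)"
  have "b > 0" using assms by (simp add: b_def)
  moreover have "2 * b / 3 = a / sqrt 2" by (simp add: b_def)
  ultimately show ?thesis
    using tail_fn_bounds[of "\<mu> powr (3/2)" b] assms
    unfolding boundary_coeff_def area_fn_def b_def[symmetric]
    by (simp add: powr_powr powr_minus_divide)
qed

lemma area_fn_deriv:
  assumes "a > 0" "\<mu> > 0"
  shows "(area_fn a has_real_derivative sqrt (2 * \<mu>) * boundary_coeff a \<mu> / a) (at \<mu>)"
proof -
  define b where "b = 3 * a / (2 * sqrt 2)"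
  have "b > 0" using assms by (simp add: b_def)
  have "((\<lambda>x. tail_fn b (x powr (3/2))) has_real_derivative
     (tail_fn b (\<mu> powr (3/2)) - (\<mu> powr (3/2)) powr (-2/3)) / b * (3/2 * \<mu> powr (3/2 - 1))) (at \<mu>)"
    using assms \<open>b > 0\<close>
    by (intro DERIV_chain2[OF tail_fn_deriv] has_real_derivative_powr) auto
  also have "(tail_fn b (\<mu> powr (3/2)) - (\<mu> powr (3/2)) powr (-2/3)) / b * (3/2 * \<mu> powr (3/2 - 1))
      = boundary_coeff a \<mu> * (3 / 2 * sqrt \<mu> / b)"
    using assms by (simp add: powr_powr powr_minus_divide boundary_coeff_def area_fn_def b_def powr_half_sqrt)
  also have "3 / 2 * sqrt \<mu> / b = sqrt (2 * \<mu>) / a"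
    using assms by (simp add: b_def real_sqrt_mult)
  finally show ?thesis by (simp add: area_fn_def[abs_def] b_def mult.commute)
qed

text \<open>By \<open>area_fn_deriv\<close> the function differentiated here is a times the
  derivative of \<open>area_fn\<close>. Multiplied by a, the result is therefore the second
  derivative of y -> \<open>area_fn a (mu + a * y)\<close>.\<close>

lemma boundary_coeff_deriv:
  assumes "a > 0" "\<mu> > 0"
  shows "((\<lambda>x. sqrt (2 * x) * boundary_coeff a x) has_real_derivative
     boundary_coeff a \<mu> / sqrt (2 * \<mu>) + 2 * \<mu> * boundary_coeff a \<mu> / a + sqrt (2 * \<mu>) / \<mu>\<^sup>2) (at \<mu>)"
proof -
  define C where "C = boundary_coeff a \<mu>"
  have "(boundary_coeff a has_real_derivative sqrt (2 * \<mu>) * C / a + 1 / \<mu>\<^sup>2) (at \<mu>)"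
    unfolding boundary_coeff_def[abs_def] C_def
    using assms by (auto intro!: derivative_eq_intros area_fn_deriv simp: boundary_coeff_def power2_eq_square)
  moreover have "((\<lambda>x. sqrt (2 * x)) has_real_derivative 1 / sqrt (2 * \<mu>)) (at \<mu>)"
    using assms by (auto intro!: derivative_eq_intros simp: field_simps)
  ultimately have "((\<lambda>x. sqrt (2 * x) * boundary_coeff a x) has_real_derivative
     1 / sqrt (2 * \<mu>) * C + (sqrt (2 * \<mu>) * C / a + 1 / \<mu>\<^sup>2) * sqrt (2 * \<mu>)) (at \<mu>)"
    unfolding C_def by (intro DERIV_mult)
  also have "(sqrt (2 * \<mu>) * C / a + 1 / \<mu>\<^sup>2) * sqrt (2 * \<mu>) = (sqrt (2 * \<mu>) * sqrt (2 * \<mu>)) * C / a + sqrt (2 * \<mu>) / \<mu>\<^sup>2"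
    by (simp add: algebra_simps)
  finally show ?thesis using assms by (simp add: C_def add.assoc)
qed

text \<open>The first quantity bounds \<open>value_fn\<close>, the second is the size of the second
  derivative of C exp (kappa y) at y = 0, and the third is that of y ->
  \<open>area_fn a (mu + a * y)\<close>. The decay mu^(-5/2) outweighs the factor mu, so each is
  controlled by its size at the lowest rate l.\<close>

lemma boundary_coeff_uniform_bounds:
  assumes a: "a > 0" and l: "l > 0"
  obtains K where "K \<ge> 0"
    "\<And>\<mu>. \<mu> \<ge> l \<Longrightarrow> \<bar>boundary_coeff a \<mu>\<bar> \<le> K"
    "\<And>\<mu>. \<mu> \<ge> l \<Longrightarrow> \<bar>boundary_coeff a \<mu>\<bar> * (2 * \<mu>) \<le> K"
    "\<And>\<mu>. \<mu> \<ge> l \<Longrightarrow> \<bar>(boundary_coeff a \<mu> / sqrt (2 * \<mu>) + 2 * \<mu> * boundary_coeff a \<mu> / a + sqrt (2 * \<mu>) / \<mu>\<^sup>2) * a\<bar> \<le> K"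
proof -
  define c where "c = a / sqrt 2"
  define K1 where "K1 = c * l powr (-5/2)"
  define K2 where "K2 = 2 * c * l powr (-3/2)"
  define K3 where "K3 = K1 / sqrt (2 * l) * a + K2 + sqrt 2 * l powr (-3/2) * a"
  have c: "c > 0" using a by (simp add: c_def)
  then have K: "K1 \<ge> 0" "K2 \<ge> 0" "K3 \<ge> 0" using a l by (auto simp: K1_def K2_def K3_def)
  have 1: "\<bar>boundary_coeff a \<mu>\<bar> \<le> K1" if "\<mu> \<ge> l" for \<mu>
  proof -
    have "\<bar>boundary_coeff a \<mu>\<bar> \<le> c * \<mu> powr (-5/2)"
      using boundary_coeff_bounds[of a \<mu>] a l that by (simp add: c_def)
    also have "\<dots> \<le> K1" unfolding K1_def using c l that
      by (intro mult_left_mono powr_mono2') auto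
    finally show ?thesis .
  qed
  have p: "\<mu> powr (-3/2) = \<mu> * \<mu> powr (-5/2)" if "\<mu> > 0" for \<mu> :: real
    using that powr_add[of \<mu> 1 "-5/2"] by simp
  have 2: "\<bar>boundary_coeff a \<mu>\<bar> * (2 * \<mu>) \<le> K2" if "\<mu> \<ge> l" for \<mu>
  proof -
    have "\<bar>boundary_coeff a \<mu>\<bar> * (2 * \<mu>) \<le> c * \<mu> powr (-5/2) * (2 * \<mu>)"
      using boundary_coeff_bounds[of a \<mu>] a l that by (intro mult_right_mono) (auto simp: c_def)
    also have "\<dots> = 2 * c * \<mu> powr (-3/2)" using p[of \<mu>] l that by simp
    also have "\<dots> \<le> K2" unfolding K2_def using c l that
      by (intro mult_left_mono powr_mono2') auto
    finally show ?thesis .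
  qed
  have 3: "\<bar>(boundary_coeff a \<mu> / sqrt (2 * \<mu>) + 2 * \<mu> * boundary_coeff a \<mu> / a + sqrt (2 * \<mu>) / \<mu>\<^sup>2) * a\<bar> \<le> K3"
    if "\<mu> \<ge> l" for \<mu>
  proof -
    have "(boundary_coeff a \<mu> / sqrt (2 * \<mu>) + 2 * \<mu> * boundary_coeff a \<mu> / a + sqrt (2 * \<mu>) / \<mu>\<^sup>2) * a
        = boundary_coeff a \<mu> / sqrt (2 * \<mu>) * a + boundary_coeff a \<mu> * (2 * \<mu>) + sqrt (2 * \<mu>) / \<mu>\<^sup>2 * a"
      using a by (simp add: field_simps)
    moreover have "\<bar>boundary_coeff a \<mu> / sqrt (2 * \<mu>) * a\<bar> \<le> K1 / sqrt (2 * l) * a"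
    proof -
      have "\<bar>boundary_coeff a \<mu> / sqrt (2 * \<mu>) * a\<bar> = \<bar>boundary_coeff a \<mu>\<bar> / sqrt (2 * \<mu>) * a"
        using a l that by (simp add: abs_mult)
      also have "\<dots> \<le> K1 / sqrt (2 * l) * a"
        using a l that K 1 by (intro mult_right_mono frac_le) auto
      finally show ?thesis .
    qed
    moreover have "\<bar>boundary_coeff a \<mu> * (2 * \<mu>)\<bar> \<le> K2"
      using 2[OF that] l that by (simp add: abs_mult)
    moreover have "\<bar>sqrt (2 * \<mu>) / \<mu>\<^sup>2 * a\<bar> \<le> sqrt 2 * l powr (-3/2) * a"
    proof -
      have "\<mu> powr (1/2) / \<mu> powr 2 = \<mu> powr (-3/2)" using powr_diff[of \<mu> "1/2" 2] by simp
      then have "sqrt (2 * \<mu>) / \<mu>\<^sup>2 = sqrt 2 * \<mu> powr (-3/2)"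
        using l that by (simp add: real_sqrt_mult powr_half_sqrt powr_numeral flip: times_divide_eq_right)
      also have "\<dots> \<le> sqrt 2 * l powr (-3/2)"
        using l that by (intro mult_left_mono powr_mono2') auto
      finally have "sqrt (2 * \<mu>) / \<mu>\<^sup>2 * a \<le> sqrt 2 * l powr (-3/2) * a"
        using a by (intro mult_right_mono) auto
      then show ?thesis using a l that by simp
    qed
    moreover have "\<bar>x + y + z\<bar> \<le> p + q + r" if "\<bar>x\<bar> \<le> p" "\<bar>y\<bar> \<le> q" "\<bar>z\<bar> \<le> r" for x y z p q r :: real
      using that by linarith
    ultimately show ?thesis unfolding K3_def by simp
  qed
  show ?thesis
  proof (rule that[of "K1 + K2 + K3"])
  qed (use K 1 2 3 in \<open>force\<close>)+
qed

text \<open>The first-order terms in \<open>y\<close> cancel: this is the boundary condition at gap zero.\<close>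

lemma boundary_mismatch_bound:
  assumes a: "a > 0" and l: "l > 0"
  obtains K where "K \<ge> 0"
    "\<And>\<mu> y. \<mu> \<ge> l \<Longrightarrow> y \<ge> 0 \<Longrightarrow>
      \<bar>area_fn a (\<mu> + a * y) - area_fn a \<mu> - boundary_coeff a \<mu> * (exp (sqrt (2 * \<mu>) * y) - 1)\<bar>
        \<le> K * (y\<^sup>2 * exp (sqrt (2 * \<mu>) * y))"
proof -
  define H where "H = (\<lambda>x. sqrt (2 * x) * boundary_coeff a x)"
  define H' where "H' = (\<lambda>x. (boundary_coeff a x / sqrt (2 * x) + 2 * x * boundary_coeff a x / a + sqrt (2 * x) / x\<^sup>2) * a)"
  obtain K where K: "K \<ge> 0"
    "\<And>\<mu>. \<mu> \<ge> l \<Longrightarrow> \<bar>boundary_coeff a \<mu>\<bar> * (2 * \<mu>) \<le> K"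
    "\<And>\<mu>. \<mu> \<ge> l \<Longrightarrow> \<bar>H' \<mu>\<bar> \<le> K"
    using boundary_coeff_uniform_bounds[OF a l] unfolding H'_def by metis
  show ?thesis
  proof (rule that[of "2 * K"])
    fix \<mu> y :: real assume \<mu>: "\<mu> \<ge> l" and y: "y \<ge> 0"
    define \<kappa> where "\<kappa> = sqrt (2 * \<mu>)"
    define C where "C = boundary_coeff a \<mu>"
    have \<kappa>: "\<kappa> > 0" "\<kappa>\<^sup>2 = 2 * \<mu>" using l \<mu> by (auto simp: \<kappa>_def)
    have nn: "\<mu> + a * t > 0" "\<mu> + a * t \<ge> l" if "t \<ge> 0" for t
      using a l \<mu> that by (auto intro: add_pos_nonneg add_increasing2)
    have "\<bar>area_fn a (\<mu> + a * y) - area_fn a (\<mu> + a * 0) - y * H (\<mu> + a * 0)\<bar> \<le> K * y\<^sup>2"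
    proof (rule second_order_remainder_bound[where f''="\<lambda>t. H' (\<mu> + a * t)" and f = "\<lambda>t. area_fn a (\<mu> + a * t)"])
      fix t assume t: "0 \<le> t" "t \<le> y"
      show "((\<lambda>t. area_fn a (\<mu> + a * t)) has_real_derivative H (\<mu> + a * t)) (at t)"
      proof -
        have "((\<lambda>t. area_fn a (\<mu> + a * t)) has_real_derivative
            sqrt (2 * (\<mu> + a * t)) * boundary_coeff a (\<mu> + a * t) / a * a) (at t)"
          using nn[OF t(1)] a
          by (intro DERIV_chain2[OF area_fn_deriv]) (auto intro!: derivative_eq_intros)
        then show ?thesis using a by (simp add: H_def)
      qed
      show "((\<lambda>t. H (\<mu> + a * t)) has_real_derivative H' (\<mu> + a * t)) (at t)"
        using nn[OF t(1)] a unfolding H_def H'_def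
        by (intro DERIV_chain2[OF boundary_coeff_deriv]) (auto intro!: derivative_eq_intros)
      show "\<bar>H' (\<mu> + a * t)\<bar> \<le> K" using nn[OF t(1)] by (intro K)
    qed fact
    then have 1: "\<bar>area_fn a (\<mu> + a * y) - area_fn a \<mu> - y * (\<kappa> * C)\<bar> \<le> K * y\<^sup>2"
      by (simp add: H_def \<kappa>_def C_def)
    \<comment> \<open>The exponential part has the same linear term y * kappa * C as
      \<open>area_fn\<close>. Its remainder carries C kappa^2 = C (2 mu), the product bounded
      separately above.\<close>
    have "\<bar>exp (\<kappa> * y) - exp (\<kappa> * 0) - y * (\<kappa> * exp (\<kappa> * 0))\<bar> \<le> (\<kappa>\<^sup>2 * exp (\<kappa> * y)) * y\<^sup>2"
      by (rule second_order_remainder_bound[where f''="\<lambda>t. \<kappa>\<^sup>2 * exp (\<kappa> * t)"])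
        (use \<kappa>(1) y in \<open>auto intro!: derivative_eq_intros simp: power2_eq_square abs_mult\<close>)
    then have "\<bar>C\<bar> * \<bar>exp (\<kappa> * y) - 1 - y * \<kappa>\<bar> \<le> \<bar>C\<bar> * ((\<kappa>\<^sup>2 * exp (\<kappa> * y)) * y\<^sup>2)"
      by (intro mult_left_mono) auto
    also have "\<dots> = (\<bar>C\<bar> * (2 * \<mu>)) * (y\<^sup>2 * exp (\<kappa> * y))" unfolding \<kappa> by (simp add: mult_ac)
    also have "\<dots> \<le> K * (y\<^sup>2 * exp (\<kappa> * y))"
      unfolding C_def using K(2)[OF \<mu>] by (intro mult_right_mono) auto
    finally have 2: "\<bar>C * (exp (\<kappa> * y) - 1 - y * \<kappa>)\<bar> \<le> K * (y\<^sup>2 * exp (\<kappa> * y))"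
      by (simp add: abs_mult)
    have 3: "K * y\<^sup>2 \<le> K * (y\<^sup>2 * exp (\<kappa> * y))"
      using K \<kappa> y by (intro mult_left_mono) (auto simp: mult_le_cancel_left1)
    have "area_fn a (\<mu> + a * y) - area_fn a \<mu> - C * (exp (\<kappa> * y) - 1)
       = (area_fn a (\<mu> + a * y) - area_fn a \<mu> - y * (\<kappa> * C)) - C * (exp (\<kappa> * y) - 1 - y * \<kappa>)"
      by (simp add: algebra_simps)
    then show "\<bar>area_fn a (\<mu> + a * y) - area_fn a \<mu> - boundary_coeff a \<mu> * (exp (sqrt (2 * \<mu>) * y) - 1)\<bar>
        \<le> 2 * K * (y\<^sup>2 * exp (sqrt (2 * \<mu>) * y))"
      using 1 2 3 unfolding C_def[symmetric] \<kappa>_def[symmetric] by linarith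
  qed (use K in auto)
qed

section \<open>One step of the walk\<close>

definition std_normal_measure :: "real measure" where
  "std_normal_measure = density lborel (\<lambda>x. ennreal (std_normal_density x))"

lemma sets_std_normal_measure [simp, measurable_cong]: "sets std_normal_measure = sets borel"
  and space_std_normal_measure [simp]: "space std_normal_measure = UNIV"
  by (auto simp: std_normal_measure_def)

lemma prob_space_std_normal_measure: "prob_space std_normal_measure"
  unfolding std_normal_measure_def by (rule prob_space_normal_density) simp

lemma integrable_std_normal_measure_iff:
  fixes g :: "real \<Rightarrow> real"
  assumes "g \<in> borel_measurable borel"
  shows "integrable std_normal_measure g \<longleftrightarrow> integrable lborel (\<lambda>x. std_normal_density x * g x)"
  unfolding std_normal_measure_def using assms by (subst integrable_density) auto

lemma integral_std_normal_measure:
  fixes g :: "real \<Rightarrow> real"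
  assumes "g \<in> borel_measurable borel"
  shows "(\<integral>x. g x \<partial>std_normal_measure) = (\<integral>x. std_normal_density x * g x \<partial>lborel)"
  unfolding std_normal_measure_def using assms by (subst integral_density) auto

lemma std_normal_measure_moments:
  shows "integrable std_normal_measure (\<lambda>x. x ^ k)"
    and "(\<integral>x. x \<partial>std_normal_measure) = 0"
    and "(\<integral>x. x\<^sup>2 \<partial>std_normal_measure) = 1"
    and "(\<integral>x. x ^ 4 \<partial>std_normal_measure) = 3"
proof -
  show "integrable std_normal_measure (\<lambda>x. x ^ k)"
    by (simp add: integrable_std_normal_measure_iff integrable_std_normal_moment)
  show "(\<integral>x. x \<partial>std_normal_measure) = 0"
    using integral_std_normal_moment_odd[of 0] by (simp add: integral_std_normal_measure)
  show "(\<integral>x. x\<^sup>2 \<partial>std_normal_measure) = 1"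
    using integral_std_normal_moment_even[of 1] by (simp add: integral_std_normal_measure)
  show "(\<integral>x. x ^ 4 \<partial>std_normal_measure) = 3"
    using integral_std_normal_moment_even[of 2] by (simp add: integral_std_normal_measure fact_numeral)
qed

text \<open>One-dimensional Cameron-Martin formula: completing the square shows that the weight exp
  (c z - c^2 / 2) turns the standard normal density into the one centred at c.\<close>

lemma std_normal_measure_tilt:
  fixes g :: "real \<Rightarrow> real"
  assumes [measurable]: "g \<in> borel_measurable borel"
  shows "integrable std_normal_measure (\<lambda>z. exp (c * z - c\<^sup>2 / 2) * g z) \<longleftrightarrow>
         integrable std_normal_measure (\<lambda>z. g (z + c))"
    and "(\<integral>z. exp (c * z - c\<^sup>2 / 2) * g z \<partial>std_normal_measure) = (\<integral>z. g (z + c) \<partial>std_normal_measure)"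
proof -
  have eq: "std_normal_density (c + z) * (exp (c * (c + z) - c\<^sup>2 / 2) * g (c + z)) = std_normal_density z * g (z + c)" for z
  proof -
    have "exp (- (c + z)\<^sup>2 / 2) * exp (c * (c + z) - c\<^sup>2 / 2) = exp (- z\<^sup>2 / 2)"
      unfolding exp_add[symmetric] by (simp add: power2_eq_square field_simps)
    then have "std_normal_density (c + z) * exp (c * (c + z) - c\<^sup>2 / 2) = std_normal_density z"
      unfolding std_normal_density_def by simp
    then show ?thesis by (metis add.commute mult.assoc)
  qed
  have "integrable std_normal_measure (\<lambda>z. exp (c * z - c\<^sup>2 / 2) * g z) \<longleftrightarrow>
    integrable lborel (\<lambda>z. std_normal_density (c + 1 * z) * (exp (c * (c + 1 * z) - c\<^sup>2 / 2) * g (c + 1 * z)))"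
    by (subst integrable_std_normal_measure_iff, measurable)
      (subst lborel_integrable_real_affine_iff[of 1 _ c, symmetric], simp_all)
  then show "integrable std_normal_measure (\<lambda>z. exp (c * z - c\<^sup>2 / 2) * g z) \<longleftrightarrow>
         integrable std_normal_measure (\<lambda>z. g (z + c))"
    by (simp add: eq integrable_std_normal_measure_iff)
  have "(\<integral>z. exp (c * z - c\<^sup>2 / 2) * g z \<partial>std_normal_measure) =
    (\<integral>z. std_normal_density (c + 1 * z) * (exp (c * (c + 1 * z) - c\<^sup>2 / 2) * g (c + 1 * z)) \<partial>lborel)"
    by (subst integral_std_normal_measure, measurable, subst lborel_integral_real_affine[where t=c and c=1]) auto
  then show "(\<integral>z. exp (c * z - c\<^sup>2 / 2) * g z \<partial>std_normal_measure) = (\<integral>z. g (z + c) \<partial>std_normal_measure)"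
    by (simp add: eq integral_std_normal_measure)
qed

lemma borel_measurable_area_fn [measurable]: "area_fn a \<in> borel_measurable borel"
  unfolding area_fn_def[abs_def] tail_fn_def set_lebesgue_integral_def by measurable

lemma borel_measurable_boundary_coeff [measurable]: "boundary_coeff a \<in> borel_measurable borel"
  unfolding boundary_coeff_def[abs_def] by measurable

text \<open>The expected remaining discounted time \<open>v\<close> at rate \<open>\<mu>\<close> and gap \<open>d\<close>.\<close>

definition value_fn :: "real \<Rightarrow> real \<Rightarrow> real \<Rightarrow> real" where
  "value_fn a \<mu> d = 1 / \<mu> + boundary_coeff a \<mu> * exp (- sqrt (2 * \<mu>) * d)"

lemma measurable_value_fn [measurable (raw)]:
  assumes "f \<in> borel_measurable M" "g \<in> borel_measurable M"
  shows "(\<lambda>x. value_fn a (f x) (g x)) \<in> borel_measurable M"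
  using assms unfolding value_fn_def by measurable

lemma value_fn_0: "value_fn a \<mu> 0 = area_fn a \<mu>"
  by (simp add: value_fn_def boundary_coeff_def)

lemma value_fn_bounded:
  assumes "a > 0" "l > 0"
  obtains K where "K \<ge> 0" "\<And>\<mu> d. \<mu> \<ge> l \<Longrightarrow> d \<ge> 0 \<Longrightarrow> \<bar>value_fn a \<mu> d\<bar> \<le> K"
proof -
  obtain K where K: "K \<ge> 0" "\<And>\<mu>. \<mu> \<ge> l \<Longrightarrow> \<bar>boundary_coeff a \<mu>\<bar> \<le> K"
    using boundary_coeff_uniform_bounds[OF assms] by metis
  show ?thesis
  proof (rule that[of "1 / l + K"])
    fix \<mu> d :: real assume \<mu>: "\<mu> \<ge> l" and d: "d \<ge> 0"
    have "\<bar>boundary_coeff a \<mu> * exp (- sqrt (2 * \<mu>) * d)\<bar> \<le> K * 1"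
      unfolding abs_mult using K(1) K(2)[OF \<mu>] assms \<mu> d by (intro mult_mono) auto
    moreover have "\<bar>1 / \<mu>\<bar> \<le> 1 / l" using assms \<mu> by (simp add: frac_le)
    ultimately show "\<bar>value_fn a \<mu> d\<bar> \<le> 1 / l + K" unfolding value_fn_def by linarith
  qed (use K assms in auto)
qed

text \<open>The value function, extended to negative gaps by its exponential formula, is reproduced exactly
  by a Gaussian step. Only the mismatch on the event that the maximum is exceeded remains; its growth
  \<open>exp (\<kappa> y)\<close> is absorbed by the discount factor through the Gaussian tilt.\<close>

lemma one_step_estimate:
  assumes a: "a > 0" and l: "l > 0"
  obtains K where "K \<ge> 0"
    "\<And>\<mu> d r. \<mu> \<ge> l \<Longrightarrow> d \<ge> 0 \<Longrightarrow> r \<ge> 0 \<Longrightarrow>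
      \<bar>exp (- \<mu> * r\<^sup>2) * (\<integral>z. value_fn a (\<mu> + a * (r * max 0 (z - d))) (r * max 0 (d - z)) \<partial>std_normal_measure)
         + r\<^sup>2 - value_fn a \<mu> (r * d)\<bar>
        \<le> K * (r\<^sup>2 * (\<integral>z. (max 0 (z - d))\<^sup>2 \<partial>std_normal_measure) + \<mu> * r ^ 4)"
proof -
  define \<nu> where "\<nu> = std_normal_measure"
  interpret \<nu>: prob_space \<nu> unfolding \<nu>_def by (rule prob_space_std_normal_measure)
  have [simp, measurable_cong]: "sets \<nu> = sets borel" by (simp add: \<nu>_def)
  obtain K where K: "K \<ge> 0"
    "\<And>\<mu> y. \<mu> \<ge> l \<Longrightarrow> y \<ge> 0 \<Longrightarrow>
      \<bar>area_fn a (\<mu> + a * y) - area_fn a \<mu> - boundary_coeff a \<mu> * (exp (sqrt (2 * \<mu>) * y) - 1)\<bar>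
        \<le> K * (y\<^sup>2 * exp (sqrt (2 * \<mu>) * y))"
    using boundary_mismatch_bound[OF assms] by metis
  show ?thesis
  proof (rule that[of "4 * K + 1"])
    fix \<mu> d r :: real assume \<mu>: "\<mu> \<ge> l" and d: "d \<ge> 0" and r: "r \<ge> 0"
    define \<kappa> where "\<kappa> = sqrt (2 * \<mu>)"
    define C where "C = boundary_coeff a \<mu>"
    define \<phi> where "\<phi> = (\<lambda>y. area_fn a (\<mu> + a * y) - area_fn a \<mu> - C * (exp (\<kappa> * y) - 1))"
    define y where "y = (\<lambda>z. r * max 0 (z - d))"
    define c where "c = \<kappa> * r"
    define m where "m = (\<integral>z. (max 0 (z - d))\<^sup>2 \<partial>\<nu>)"
    \<comment> \<open>With c = kappa r, the discount exp (- mu r^2) over one step is exactly the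
      normaliser exp (- c^2 / 2) of the tilt. This is why the exponential part of the value is
      preserved exactly.\<close>
    have \<mu>0: "\<mu> > 0" and \<kappa>: "\<kappa> > 0" "\<kappa>\<^sup>2 = 2 * \<mu>" using l \<mu> by (auto simp: \<kappa>_def)
    have c2: "c\<^sup>2 / 2 = \<mu> * r\<^sup>2" using \<kappa> by (simp add: c_def power_mult_distrib)
    have [measurable]: "y \<in> borel_measurable borel" "\<phi> \<in> borel_measurable borel"
      unfolding y_def \<phi>_def by measurable
    have int2: "integrable \<nu> (\<lambda>z. z\<^sup>2)" unfolding \<nu>_def by (rule std_normal_measure_moments)
    have sq: "(max 0 (z - d))\<^sup>2 \<le> z\<^sup>2" for z 
      using d by (cases "z > d") (auto intro!: power_mono)
    have int_m: "integrable \<nu> (\<lambda>z. (max 0 (z - d))\<^sup>2)"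
      by (rule Bochner_Integration.integrable_bound[OF int2]) (use sq in auto)
    \<comment> \<open>Tilting shifts z by c. The price 2 c^2 = 4 mu r^2, multiplied by r^2,
      contributes to the \<open>\<mu> * r ^ 4\<close> term of the error.\<close>
    have shift: "(y (z + c))\<^sup>2 \<le> r\<^sup>2 * (2 * (max 0 (z - d))\<^sup>2 + 2 * c\<^sup>2)" for z
    proof -
      have "0 \<le> c" using \<kappa> r by (simp add: c_def)
      then have "(max 0 (z + c - d))\<^sup>2 \<le> (max 0 (z - d) + c)\<^sup>2" by (intro power_mono) auto
      also have "\<dots> \<le> 2 * (max 0 (z - d))\<^sup>2 + 2 * c\<^sup>2" using sum_squares_bound[of "max 0 (z - d)" c] by (simp add: power2_sum)
      finally show ?thesis unfolding y_def power_mult_distrib by (intro mult_left_mono) auto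
    qed
    have int_shift: "integrable \<nu> (\<lambda>z. (y (z + c))\<^sup>2)"
      by (rule Bochner_Integration.integrable_bound[where f="\<lambda>z. r\<^sup>2 * (2 * (max 0 (z - d))\<^sup>2 + 2 * c\<^sup>2)"])
         (use shift int_m in auto)
    have y2: "(\<integral>z. exp (c * z - c\<^sup>2 / 2) * (y z)\<^sup>2 \<partial>\<nu>) \<le> 2 * r\<^sup>2 * m + 4 * \<mu> * r ^ 4"
    proof -
      have "(\<integral>z. exp (c * z - c\<^sup>2 / 2) * (y z)\<^sup>2 \<partial>\<nu>) = (\<integral>z. (y (z + c))\<^sup>2 \<partial>\<nu>)"
        unfolding \<nu>_def by (rule std_normal_measure_tilt) measurable
      also have "\<dots> \<le> (\<integral>z. r\<^sup>2 * (2 * (max 0 (z - d))\<^sup>2 + 2 * c\<^sup>2) \<partial>\<nu>)"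
        by (rule integral_mono) (use int_m shift int_shift in auto)
      also have "\<dots> = r\<^sup>2 * (2 * m + 2 * c\<^sup>2)"
        using int_m by (simp add: m_def \<nu>.prob_space)
      also have "\<dots> = 2 * r\<^sup>2 * m + 4 * \<mu> * r ^ 4"
      proof -
        have "c\<^sup>2 = 2 * \<mu> * r\<^sup>2" using c2 by simp
        then show ?thesis by (simp add: algebra_simps power2_eq_square power4_eq_xxxx)
      qed
      finally show ?thesis .
    qed
    have int_y2: "integrable \<nu> (\<lambda>z. exp (c * z - c\<^sup>2 / 2) * (y z)\<^sup>2)"
      using int_shift unfolding \<nu>_def by (subst std_normal_measure_tilt) auto
    have e1: "integrable \<nu> (\<lambda>z. exp (c * z - c\<^sup>2 / 2))" "(\<integral>z. exp (c * z - c\<^sup>2 / 2) \<partial>\<nu>) = 1"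
      using std_normal_measure_tilt[of "\<lambda>_. 1" c] unfolding \<nu>_def[symmetric] by (simp_all add: \<nu>.prob_space)
    have \<phi>_bound: "\<bar>exp (- \<mu> * r\<^sup>2) * \<phi> (y z)\<bar> \<le> K * (exp (c * z - c\<^sup>2 / 2) * (y z)\<^sup>2)" for z
    proof -
      have "\<bar>\<phi> (y z)\<bar> \<le> K * ((y z)\<^sup>2 * exp (\<kappa> * y z))"
        unfolding \<phi>_def \<kappa>_def C_def using r \<mu> by (intro K) (auto simp: y_def)
      \<comment> \<open>For z > d the exponent kappa r (z - d) is at most c z because d >= 0; for z
        <= d both sides vanish.\<close>
      also have "(y z)\<^sup>2 * exp (\<kappa> * y z) \<le> (y z)\<^sup>2 * exp (c * z)"
      proof (cases "z > d")
        case True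
        then show ?thesis unfolding y_def c_def using \<kappa> r d
          by (intro mult_left_mono) (auto simp: mult.assoc intro!: mult_left_mono)
      qed (simp add: y_def)
      finally have "\<bar>\<phi> (y z)\<bar> \<le> K * ((y z)\<^sup>2 * exp (c * z))" using K by (simp add: mult_left_mono)
      then have "exp (- \<mu> * r\<^sup>2) * \<bar>\<phi> (y z)\<bar> \<le> exp (- \<mu> * r\<^sup>2) * (K * ((y z)\<^sup>2 * exp (c * z)))"
        by (intro mult_left_mono) auto
      also have "\<dots> = K * (exp (c * z - c\<^sup>2 / 2) * (y z)\<^sup>2)"
        unfolding c2 by (simp add: exp_diff exp_minus field_simps)
      finally show ?thesis by (simp add: abs_mult)
    qed
    have int_\<phi>: "integrable \<nu> (\<lambda>z. exp (- \<mu> * r\<^sup>2) * \<phi> (y z))"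
      by (rule Bochner_Integration.integrable_bound[where f="\<lambda>z. K * (exp (c * z - c\<^sup>2 / 2) * (y z)\<^sup>2)"])
         (use \<phi>_bound int_y2 K in \<open>auto simp: order.trans[OF _ abs_ge_self]\<close>)
    define E where "E = (\<integral>z. exp (- \<mu> * r\<^sup>2) * \<phi> (y z) \<partial>\<nu>)"
    have "\<bar>E\<bar> \<le> (\<integral>z. \<bar>exp (- \<mu> * r\<^sup>2) * \<phi> (y z)\<bar> \<partial>\<nu>)"
      unfolding E_def by (rule integral_abs_bound)
    also have "\<dots> \<le> (\<integral>z. K * (exp (c * z - c\<^sup>2 / 2) * (y z)\<^sup>2) \<partial>\<nu>)"
      by (rule integral_mono) (use int_\<phi> int_y2 \<phi>_bound in auto)
    also have "\<dots> \<le> K * (2 * r\<^sup>2 * m + 4 * \<mu> * r ^ 4)"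
      using y2 K by (simp add: mult_left_mono)
    finally have E: "\<bar>E\<bar> \<le> K * (2 * r\<^sup>2 * m + 4 * \<mu> * r ^ 4)" .
    \<comment> \<open>The new value is the exponential formula at the signed gap r (d - z), plus the
      mismatch \<open>\<phi>\<close>. The mismatch vanishes when z <= d, since then y z = 0.\<close>
    have split: "exp (- \<mu> * r\<^sup>2) * value_fn a (\<mu> + a * y z) (r * max 0 (d - z))
       = exp (- \<mu> * r\<^sup>2) / \<mu> + C * exp (- \<kappa> * (r * d)) * exp (c * z - c\<^sup>2 / 2) + exp (- \<mu> * r\<^sup>2) * \<phi> (y z)" for z
    proof -
      have "exp (- \<mu> * r\<^sup>2) * exp (- \<kappa> * (r * (d - z))) = exp (- \<kappa> * (r * d)) * exp (c * z - c\<^sup>2 / 2)"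
        unfolding c2 exp_add[symmetric] by (simp add: c_def algebra_simps)
      moreover have "value_fn a (\<mu> + a * y z) (r * max 0 (d - z)) = 1 / \<mu> + C * exp (- \<kappa> * (r * (d - z))) + \<phi> (y z)"
      proof (cases "z > d")
        case True
        then have "- \<kappa> * (r * (d - z)) = \<kappa> * y z" by (simp add: y_def algebra_simps)
        then show ?thesis using True
          by (simp only:) (simp add: value_fn_0 \<phi>_def C_def boundary_coeff_def algebra_simps)
      qed (simp add: y_def \<phi>_def value_fn_def C_def \<kappa>_def)
      ultimately show ?thesis by (simp add: algebra_simps)
    qed
    have "exp (- \<mu> * r\<^sup>2) * (\<integral>z. value_fn a (\<mu> + a * y z) (r * max 0 (d - z)) \<partial>\<nu>)
       = (\<integral>z. exp (- \<mu> * r\<^sup>2) * value_fn a (\<mu> + a * y z) (r * max 0 (d - z)) \<partial>\<nu>)" by simp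
    also have "\<dots> = exp (- \<mu> * r\<^sup>2) / \<mu> + C * exp (- \<kappa> * (r * d)) + E"
      unfolding split E_def using e1 int_\<phi> by (simp add: \<nu>.prob_space)
    \<comment> \<open>The exact reward over one step at constant rate mu would be (1 - exp (- mu
      r^2)) / mu. The last summand is the cost of using r^2 in its place.\<close>
    finally have main: "exp (- \<mu> * r\<^sup>2) * (\<integral>z. value_fn a (\<mu> + a * y z) (r * max 0 (d - z)) \<partial>\<nu>)
        + r\<^sup>2 - value_fn a \<mu> (r * d) = E + (exp (- (\<mu> * r\<^sup>2)) - 1 + \<mu> * r\<^sup>2) / \<mu>"
      using \<mu>0 by (simp add: value_fn_def C_def \<kappa>_def field_simps)
    have "\<bar>exp (- (\<mu> * r\<^sup>2)) - exp (- 0) - (\<mu> * r\<^sup>2) * (- exp (- 0))\<bar> \<le> 1 * (\<mu> * r\<^sup>2)\<^sup>2"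
      by (rule second_order_remainder_bound[where f = "\<lambda>t. exp (- t)" and f' = "\<lambda>t. - exp (- t)" and f''="\<lambda>t. exp (- t)"])
        (use \<mu>0 in \<open>auto intro!: derivative_eq_intros\<close>)
    then have "\<bar>(exp (- (\<mu> * r\<^sup>2)) - 1 + \<mu> * r\<^sup>2) / \<mu>\<bar> \<le> (\<mu> * r\<^sup>2)\<^sup>2 / \<mu>"
      using \<mu>0 by (simp add: divide_right_mono)
    also have "\<dots> = \<mu> * r ^ 4" using \<mu>0 by (simp add: power2_eq_square power4_eq_xxxx)
    finally have R: "\<bar>(exp (- (\<mu> * r\<^sup>2)) - 1 + \<mu> * r\<^sup>2) / \<mu>\<bar> \<le> \<mu> * r ^ 4" .
    have "m \<ge> 0" by (simp add: m_def)
    then have "K * (2 * r\<^sup>2 * m) \<le> 4 * K * (r\<^sup>2 * m)" "0 \<le> r\<^sup>2 * m" using K by (auto simp: mult_mono)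
    with E R have "\<bar>E\<bar> + \<bar>(exp (- (\<mu> * r\<^sup>2)) - 1 + \<mu> * r\<^sup>2) / \<mu>\<bar> \<le> (4 * K + 1) * (r\<^sup>2 * m + \<mu> * r ^ 4)"
      by (simp add: algebra_simps)
    then show "\<bar>exp (- \<mu> * r\<^sup>2) * (\<integral>z. value_fn a (\<mu> + a * (r * max 0 (z - d))) (r * max 0 (d - z)) \<partial>std_normal_measure)
         + r\<^sup>2 - value_fn a \<mu> (r * d)\<bar>
        \<le> (4 * K + 1) * (r\<^sup>2 * (\<integral>z. (max 0 (z - d))\<^sup>2 \<partial>std_normal_measure) + \<mu> * r ^ 4)"
      using main abs_triangle_ineq[of E] unfolding y_def \<nu>_def[symmetric] m_def by (metis (no_types, lifting) order.trans)
  qed (use K in auto)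
qed

section \<open>Random walk with normal increments\<close>

text \<open>The gap between the running maximum of the partial sums of \<open>x\<close> and the current partial
  sum; \<open>walk_max\<close> below is that running maximum.\<close>

fun walk_gap :: "(nat \<Rightarrow> real) \<Rightarrow> nat \<Rightarrow> real" where
  "walk_gap x 0 = 0"
| "walk_gap x (Suc k) = max 0 (walk_gap x k - x k)"

fun walk_max :: "(nat \<Rightarrow> real) \<Rightarrow> nat \<Rightarrow> real" where
  "walk_max x 0 = 0"
| "walk_max x (Suc k) = walk_max x k + max 0 (x k - walk_gap x k)"

lemma walk_gap_nonneg: "walk_gap x k \<ge> 0"
  by (cases k) auto

lemma walk_max_nonneg: "walk_max x k \<ge> 0"
  by (induction k) auto

lemma walk_max_mono: "i \<le> k \<Longrightarrow> walk_max x i \<le> walk_max x k"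
  by (rule lift_Suc_mono_le[of "walk_max x"]) auto

lemma walk_max_minus_gap: "walk_max x k = walk_gap x k + (\<Sum>j<k. x j)"
  by (induction k) auto

lemma partial_sum_le_walk_max:
  assumes "j \<le> k"
  shows "(\<Sum>i<j. x i) \<le> walk_max x k"
  using walk_max_minus_gap[of x j] walk_gap_nonneg[of x j] walk_max_mono[OF assms, of x] by linarith

lemma walk_max_attained: "\<exists>j\<le>k. walk_max x k = (\<Sum>i<j. x i)"
proof (induction k)
  case (Suc k)
  show ?case
  proof (cases "x k \<le> walk_gap x k")
    case True
    then show ?thesis using Suc by (auto intro: le_SucI)
  next
    case False
    then have "walk_max x (Suc k) = (\<Sum>i<Suc k. x i)" using walk_max_minus_gap[of x k] by simp
    then show ?thesis by blast
  qed
qed simp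

lemma walk_gap_scale: "r \<ge> 0 \<Longrightarrow> walk_gap (\<lambda>i. r * x i) k = r * walk_gap x k"
  by (induction k) (auto simp: max_mult_distrib_left right_diff_distrib)

lemma walk_max_scale: "r \<ge> 0 \<Longrightarrow> walk_max (\<lambda>i. r * x i) k = r * walk_max x k"
  by (induction k) (auto simp: walk_gap_scale max_mult_distrib_left right_diff_distrib distrib_left)

lemma walk_gap_cong: "(\<And>i. i < k \<Longrightarrow> x i = y i) \<Longrightarrow> walk_gap x k = walk_gap y k"
  by (induction k) auto

lemma walk_max_cong:
  assumes "\<And>i. i < k \<Longrightarrow> x i = y i"
  shows "walk_max x k = walk_max y k"
  using assms
proof (induction k)
  case (Suc k)
  then show ?case using walk_gap_cong[of k x y] by simp
qed simp

lemma measurable_walk_gap: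
  "(\<And>i. i < k \<Longrightarrow> (\<lambda>\<omega>. X \<omega> i) \<in> borel_measurable M) \<Longrightarrow> (\<lambda>\<omega>. walk_gap (X \<omega>) k) \<in> borel_measurable M"
  by (induction k) auto

lemma measurable_walk_max:
  "(\<And>i. i < k \<Longrightarrow> (\<lambda>\<omega>. X \<omega> i) \<in> borel_measurable M) \<Longrightarrow> (\<lambda>\<omega>. walk_max (X \<omega>) k) \<in> borel_measurable M"
proof (induction k)
  case (Suc k)
  then have [measurable]: "(\<lambda>\<omega>. walk_max (X \<omega>) k) \<in> borel_measurable M" "(\<lambda>\<omega>. X \<omega> k) \<in> borel_measurable M"
    "(\<lambda>\<omega>. walk_gap (X \<omega>) k) \<in> borel_measurable M"
    by (auto intro: measurable_walk_gap)
  show ?case by simp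
qed simp

text \<open>A left-endpoint sum: the contribution of the next step is \<open>walk_max x k\<close>,
  already known before that step. The discount over a step is thus fixed by the state before
  it.\<close>

definition walk_area :: "(nat \<Rightarrow> real) \<Rightarrow> nat \<Rightarrow> real" where
  "walk_area x k = (\<Sum>j<k. walk_max x j)"

lemma walk_area_nonneg: "walk_area x k \<ge> 0"
  unfolding walk_area_def by (intro sum_nonneg walk_max_nonneg)

lemma walk_area_scale: "r \<ge> 0 \<Longrightarrow> walk_area (\<lambda>i. r * x i) k = r * walk_area x k"
  unfolding walk_area_def by (simp add: walk_max_scale sum_distrib_left)

lemma walk_area_cong: "(\<And>i. i < k \<Longrightarrow> x i = y i) \<Longrightarrow> walk_area x k = walk_area y k"
  unfolding walk_area_def by (intro sum.cong walk_max_cong) auto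

lemma measurable_walk_area:
  "(\<And>i. i < k \<Longrightarrow> (\<lambda>\<omega>. X \<omega> i) \<in> borel_measurable M) \<Longrightarrow> (\<lambda>\<omega>. walk_area (X \<omega>) k) \<in> borel_measurable M"
  unfolding walk_area_def by (intro borel_measurable_sum measurable_walk_max) auto

section \<open>Markov step and moments of the walk\<close>

lemma (in prob_space) indep_var_integrate_out:
  fixes f :: "'b \<Rightarrow> 'b \<Rightarrow> real"
  assumes ind: "indep_var N X L Y"
    and f: "case_prod f \<in> borel_measurable (N \<Otimes>\<^sub>M L)"
    and int: "integrable M (\<lambda>\<omega>. f (X \<omega>) (Y \<omega>))"
  shows "integrable M (\<lambda>\<omega>. \<integral>y. f (X \<omega>) y \<partial>distr M L Y)"
    and "expectation (\<lambda>\<omega>. f (X \<omega>) (Y \<omega>)) = expectation (\<lambda>\<omega>. \<integral>y. f (X \<omega>) y \<partial>distr M L Y)"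
proof -
  have [measurable]: "X \<in> measurable M N" "Y \<in> measurable M L"
    using ind by (auto dest: indep_var_rv1 indep_var_rv2)
  note f[measurable]
  interpret X: prob_space "distr M N X" by (rule prob_space_distr) simp
  interpret Y: prob_space "distr M L Y" by (rule prob_space_distr) simp
  interpret XY: pair_prob_space "distr M N X" "distr M L Y" ..
  have eq: "distr M N X \<Otimes>\<^sub>M distr M L Y = distr M (N \<Otimes>\<^sub>M L) (\<lambda>x. (X x, Y x))"
    using ind unfolding indep_var_distribution_eq by simp
  have int2: "integrable (distr M N X \<Otimes>\<^sub>M distr M L Y) (case_prod f)"
    unfolding eq by (subst integrable_distr_eq) (use int in auto)
  have m: "(\<lambda>x. \<integral>y. f x y \<partial>distr M L Y) \<in> borel_measurable N"
    by (rule Y.borel_measurable_lebesgue_integral) simp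
  show "integrable M (\<lambda>\<omega>. \<integral>y. f (X \<omega>) y \<partial>distr M L Y)"
    using XY.integrable_fst[OF int2] m by (subst (asm) integrable_distr_eq) auto
  have "expectation (\<lambda>\<omega>. f (X \<omega>) (Y \<omega>)) = integral\<^sup>L (distr M N X \<Otimes>\<^sub>M distr M L Y) (case_prod f)"
    unfolding eq by (subst integral_distr) auto
  also have "\<dots> = (\<integral>x. (\<integral>y. f x y \<partial>distr M L Y) \<partial>distr M N X)"
    using XY.integral_fst[OF int2] by simp
  also have "\<dots> = expectation (\<lambda>\<omega>. \<integral>y. f (X \<omega>) y \<partial>distr M L Y)"
    using m by (subst integral_distr) auto
  finally show "expectation (\<lambda>\<omega>. f (X \<omega>) (Y \<omega>)) = expectation (\<lambda>\<omega>. \<integral>y. f (X \<omega>) y \<partial>distr M L Y)" .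
qed

locale iid_normal = prob_space M for M :: "'a measure" +
  fixes \<xi> :: "nat \<Rightarrow> 'a \<Rightarrow> real"
  assumes indep: "indep_vars (\<lambda>_. borel) \<xi> {..<n}"
    and law: "distr M borel (\<xi> k) = std_normal_measure"
begin

lemma measurable_\<xi> [measurable]: "\<xi> k \<in> borel_measurable M"
  using indep[of "Suc k"] unfolding indep_vars_def by auto

abbreviation "D k \<omega> \<equiv> walk_gap (\<lambda>i. \<xi> i \<omega>) k"
abbreviation "S k \<omega> \<equiv> walk_max (\<lambda>i. \<xi> i \<omega>) k"
abbreviation "A k \<omega> \<equiv> walk_area (\<lambda>i. \<xi> i \<omega>) k"

lemma measurable_walk [measurable]:
  "D k \<in> borel_measurable M" "S k \<in> borel_measurable M" "A k \<in> borel_measurable M"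
  by (auto intro: measurable_walk_gap measurable_walk_max measurable_walk_area)

text \<open>The state depends on the steps below k only. Since \<open>indep_var\<close> takes two
  variables of one type, the next step is padded with two zeros to match the state triple.\<close>

lemma indep_step:
  "indep_var borel (\<lambda>\<omega>. (D k \<omega>, S k \<omega>, A k \<omega>)) borel (\<lambda>\<omega>. (\<xi> k \<omega>, 0 :: real, 0 :: real))"
proof -
  let ?P = "\<lambda>I. PiM I (\<lambda>_::nat. borel :: real measure)"
  let ?st = "\<lambda>x. (walk_gap x k, walk_max x k, walk_area x k)"
  have 1: "indep_var (?P {..<k}) (\<lambda>\<omega>. restrict (\<lambda>i. \<xi> i \<omega>) {..<k}) (?P {k}) (\<lambda>\<omega>. restrict (\<lambda>i. \<xi> i \<omega>) {k})"
    by (rule indep_var_restrict[OF indep[of "Suc k"]]) auto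
  have "indep_var borel (?st \<circ> (\<lambda>\<omega>. restrict (\<lambda>i. \<xi> i \<omega>) {..<k}))
                  borel ((\<lambda>x. (x k, 0 :: real, 0 :: real)) \<circ> (\<lambda>\<omega>. restrict (\<lambda>i. \<xi> i \<omega>) {k}))"
    by (rule indep_var_compose[OF 1])
       (auto intro!: borel_measurable_Pair measurable_walk_gap measurable_walk_max measurable_walk_area)
  also have "?st \<circ> (\<lambda>\<omega>. restrict (\<lambda>i. \<xi> i \<omega>) {..<k}) = (\<lambda>\<omega>. (D k \<omega>, S k \<omega>, A k \<omega>))"
    by (auto simp: fun_eq_iff intro!: walk_gap_cong walk_max_cong walk_area_cong)
  also have "(\<lambda>x. (x k, 0 :: real, 0 :: real)) \<circ> (\<lambda>\<omega>. restrict (\<lambda>i. \<xi> i \<omega>) {k}) = (\<lambda>\<omega>. (\<xi> k \<omega>, 0, 0))" by auto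
  finally show ?thesis .
qed

text \<open>The Markov property in the form used below: by independence and Fubini, the next step is
  integrated out with the state frozen.\<close>

lemma expectation_step:
  fixes f :: "real \<Rightarrow> real \<Rightarrow> real \<Rightarrow> real \<Rightarrow> real"
  assumes f: "(\<lambda>((d, s, q), z). f d s q z) \<in> borel_measurable (borel :: ((real \<times> real \<times> real) \<times> real) measure)"
    and int: "integrable M (\<lambda>\<omega>. f (D k \<omega>) (S k \<omega>) (A k \<omega>) (\<xi> k \<omega>))"
  shows "integrable M (\<lambda>\<omega>. \<integral>z. f (D k \<omega>) (S k \<omega>) (A k \<omega>) z \<partial>std_normal_measure)"
    and "expectation (\<lambda>\<omega>. f (D k \<omega>) (S k \<omega>) (A k \<omega>) (\<xi> k \<omega>)) =
         expectation (\<lambda>\<omega>. \<integral>z. f (D k \<omega>) (S k \<omega>) (A k \<omega>) z \<partial>std_normal_measure)"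
proof -
  let ?f = "\<lambda>(d, s, q) (z, _ :: real \<times> real). f d s q z"
  let ?L = "distr M borel (\<lambda>\<omega>. (\<xi> k \<omega>, 0 :: real, 0 :: real))"
  have "(\<lambda>x. (fst x, fst (snd x))) \<in> borel_measurable (borel :: ((real \<times> real \<times> real) \<times> (real \<times> real \<times> real)) measure)"
    by (intro borel_measurable_Pair borel_measurable_continuous_onI continuous_intros)
  from measurable_compose[OF this f] have f': "case_prod ?f \<in> borel_measurable (borel \<Otimes>\<^sub>M borel)"
    by (simp add: borel_prod case_prod_beta')
  have inner: "(\<integral>y. ?f (d, s, q) y \<partial>?L) = (\<integral>z. f d s q z \<partial>std_normal_measure)" for d s q
  proof -
    have "(\<lambda>z. ((d, s, q), z)) \<in> borel_measurable borel"
      by (intro borel_measurable_continuous_onI continuous_intros)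
    from measurable_compose[OF this f] have m: "(\<lambda>z. f d s q z) \<in> borel_measurable borel"
      by simp
    have m2: "(\<lambda>y. f d s q (fst y)) \<in> borel_measurable (borel :: (real \<times> real \<times> real) measure)"
      by (rule measurable_compose[OF _ m]) (intro borel_measurable_continuous_onI continuous_intros)
    have "(\<integral>y. ?f (d, s, q) y \<partial>?L) = (\<integral>\<omega>. f d s q (\<xi> k \<omega>) \<partial>M)"
      unfolding prod.case case_prod_beta' fst_conv snd_conv
      by (subst integral_distr[OF _ m2]) (auto intro!: borel_measurable_Pair)
    also have "\<dots> = (\<integral>z. f d s q z \<partial>std_normal_measure)"
      unfolding law[of k, symmetric] using m by (subst integral_distr) auto
    finally show ?thesis .
  qed
  have int': "integrable M (\<lambda>\<omega>. ?f (D k \<omega>, S k \<omega>, A k \<omega>) (\<xi> k \<omega>, 0, 0))" using int by simp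
  note * = indep_var_integrate_out[OF indep_step f' int', unfolded inner]
  show "integrable M (\<lambda>\<omega>. \<integral>z. f (D k \<omega>) (S k \<omega>) (A k \<omega>) z \<partial>std_normal_measure)"
    using *(1) .
  show "expectation (\<lambda>\<omega>. f (D k \<omega>) (S k \<omega>) (A k \<omega>) (\<xi> k \<omega>)) =
         expectation (\<lambda>\<omega>. \<integral>z. f (D k \<omega>) (S k \<omega>) (A k \<omega>) z \<partial>std_normal_measure)"
    using *(2) by simp
qed

lemma \<xi>_transfer:
  assumes [measurable]: "g \<in> borel_measurable borel"
  shows "integrable M (\<lambda>\<omega>. g (\<xi> k \<omega>) :: real) \<longleftrightarrow> integrable std_normal_measure g"
    and "expectation (\<lambda>\<omega>. g (\<xi> k \<omega>)) = (\<integral>z. g z \<partial>std_normal_measure)"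
  unfolding law[of k, symmetric] by (simp_all add: integrable_distr_eq integral_distr)

lemma \<xi>_moments:
  shows "integrable M (\<lambda>\<omega>. \<xi> k \<omega> ^ p)" "integrable M (\<xi> k)"
    "expectation (\<xi> k) = 0" "expectation (\<lambda>\<omega>. (\<xi> k \<omega>)\<^sup>2) = 1" "expectation (\<lambda>\<omega>. \<xi> k \<omega> ^ 4) = 3"
  using \<xi>_transfer[of "\<lambda>x. x ^ p" k] \<xi>_transfer[of "\<lambda>x. x" k] \<xi>_transfer[of "\<lambda>x. x\<^sup>2" k] \<xi>_transfer[of "\<lambda>x. x ^ 4" k]
    std_normal_measure_moments(1)[of p] std_normal_measure_moments(1)[of 1] std_normal_measure_moments(2-4)
  by simp_all

lemma integrable_gap_sq: "integrable M (\<lambda>\<omega>. (D k \<omega>)\<^sup>2)"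
proof (induction k)
  case (Suc k)
  have b: "(max 0 (d - x))\<^sup>2 \<le> 2 * d\<^sup>2 + 2 * x\<^sup>2" for d x :: real
  proof -
    have "(max 0 (d - x))\<^sup>2 \<le> (d - x)\<^sup>2" by (auto simp: max_def)
    also have "\<dots> \<le> 2 * d\<^sup>2 + 2 * x\<^sup>2" using sum_squares_bound[of d "-x"] by (simp add: power2_diff)
    finally show ?thesis .
  qed
  show ?case
    by (rule Bochner_Integration.integrable_bound[where f="\<lambda>\<omega>. 2 * (D k \<omega>)\<^sup>2 + 2 * (\<xi> k \<omega>)\<^sup>2"])
       (use Suc \<xi>_moments(1)[of k 2] b in auto)
qed simp

lemma integrable_gap: "integrable M (D k)"
  by (rule square_integrable_imp_integrable[OF _ integrable_gap_sq]) simp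

lemma integrable_max: "integrable M (S k)"
  unfolding walk_max_minus_gap using integrable_gap \<xi>_moments by auto

text \<open>Maximum and gap differ by the partial sum of the steps, which is centred.\<close>

lemma expectation_max_eq: "expectation (S k) = expectation (D k)"
  unfolding walk_max_minus_gap using integrable_gap \<xi>_moments by simp

text \<open>Clipping at zero only decreases the square of d - x, the cross term vanishes by
  independence, and each step adds variance 1.\<close>

lemma expectation_gap_sq_le: "expectation (\<lambda>\<omega>. (D k \<omega>)\<^sup>2) \<le> real k"
proof (induction k)
  case (Suc k)
  have i: "integrable M (\<lambda>\<omega>. D k \<omega> * \<xi> k \<omega>)"
  proof (rule Bochner_Integration.integrable_bound[where f="\<lambda>\<omega>. (D k \<omega>)\<^sup>2 + (\<xi> k \<omega>)\<^sup>2"])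
    have "\<bar>d * x\<bar> \<le> d\<^sup>2 + x\<^sup>2" for d x :: real
      using sum_squares_bound[of d x] sum_squares_bound[of d "-x"] zero_le_power2[of d] zero_le_power2[of x]
      by (simp add: abs_le_iff)
    then show "AE \<omega> in M. norm (D k \<omega> * \<xi> k \<omega>) \<le> norm ((D k \<omega>)\<^sup>2 + (\<xi> k \<omega>)\<^sup>2)" by simp
  qed (use integrable_gap_sq \<xi>_moments(1)[of k 2] in auto)
  have 0: "expectation (\<lambda>\<omega>. D k \<omega> * \<xi> k \<omega>) = 0"
  proof -
    have "(\<lambda>((d, s, q), z). d * z) \<in> borel_measurable (borel :: ((real \<times> real \<times> real) \<times> real) measure)"
      unfolding case_prod_beta' by (intro borel_measurable_continuous_onI continuous_intros)
    from expectation_step(2)[OF this i] show ?thesis by (simp add: std_normal_measure_moments)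
  qed
  have "expectation (\<lambda>\<omega>. (D (Suc k) \<omega>)\<^sup>2) \<le> expectation (\<lambda>\<omega>. (D k \<omega>)\<^sup>2 - 2 * (D k \<omega> * \<xi> k \<omega>) + (\<xi> k \<omega>)\<^sup>2)"
  proof (rule integral_mono)
    have "(max 0 (d - x))\<^sup>2 \<le> (d - x)\<^sup>2" for d x :: real by (auto simp: max_def)
    from this[of "D k \<omega>" "\<xi> k \<omega>" for \<omega>]
    show "(D (Suc k) \<omega>)\<^sup>2 \<le> (D k \<omega>)\<^sup>2 - 2 * (D k \<omega> * \<xi> k \<omega>) + (\<xi> k \<omega>)\<^sup>2" for \<omega>
      by (simp add: power2_diff mult.assoc algebra_simps)
  qed (use i integrable_gap_sq[of k] integrable_gap_sq[of "Suc k"] \<xi>_moments(1)[of k 2] in auto)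
  also have "\<dots> = expectation (\<lambda>\<omega>. (D k \<omega>)\<^sup>2) + 1"
    using i 0 integrable_gap_sq[of k] \<xi>_moments(1)[of k 2] \<xi>_moments(4) by simp
  finally show ?case using Suc by simp
qed simp

lemma expectation_max_le: "expectation (S k) \<le> sqrt k"
proof (cases "k = 0")
  case False
  define s where "s = sqrt k"
  have s: "s > 0" "s\<^sup>2 = k" using False by (auto simp: s_def)
  \<comment> \<open>The arithmetic-geometric mean inequality with s = sqrt k converts the second
    moment bound into a first moment bound.\<close>
  have "expectation (D k) \<le> expectation (\<lambda>\<omega>. (D k \<omega>)\<^sup>2 / (2 * s) + s / 2)"
  proof (rule integral_mono)
    show "D k \<omega> \<le> (D k \<omega>)\<^sup>2 / (2 * s) + s / 2" for \<omega>
    proof -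
      have "2 * s * D k \<omega> \<le> (D k \<omega>)\<^sup>2 + s\<^sup>2" using sum_squares_bound[of s "D k \<omega>"] by simp
      then show ?thesis using s(1) by (simp add: field_simps power2_eq_square)
    qed
  qed (use integrable_gap integrable_gap_sq in auto)
  also have "\<dots> = expectation (\<lambda>\<omega>. (D k \<omega>)\<^sup>2) / (2 * s) + s / 2"
    using integrable_gap_sq by (simp add: prob_space)
  also have "\<dots> \<le> s\<^sup>2 / (2 * s) + s / 2"
    using expectation_gap_sq_le s by (intro add_right_mono divide_right_mono) auto
  also have "\<dots> = s" using s(1) by (simp add: power2_eq_square)
  finally show ?thesis unfolding s_def expectation_max_eq .
qed simp

abbreviation "\<eta> k \<omega> \<equiv> max 0 (\<xi> k \<omega> - D k \<omega>)"

lemma \<eta>_le: "(\<eta> k \<omega>) \<le> \<bar>\<xi> k \<omega>\<bar>"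
  using walk_gap_nonneg[of "\<lambda>i. \<xi> i \<omega>" k] by auto

lemma \<eta>_sq_le: "(\<eta> k \<omega>)\<^sup>2 \<le> (\<xi> k \<omega>)\<^sup>2"
  using \<eta>_le[of k \<omega>] power_mono[OF \<eta>_le, of k \<omega> 2] by simp

lemma integrable_\<eta>_sq: "integrable M (\<lambda>\<omega>. (\<eta> k \<omega>)\<^sup>2)"
  by (rule Bochner_Integration.integrable_bound[OF \<xi>_moments(1)[of k 2]])
     (use \<eta>_sq_le in auto)

text \<open>The bound by the variances of the steps would give n, and r^2 n is the whole time
  horizon, which does not vanish. An increment of at most eps is charged eps times the growth of the
  maximum, which telescopes to eps sqrt n. A larger one satisfies eta^2 <= xi^4 / eps^2, and the
  fourth moment of a step is 3.\<close>

lemma sum_increment_sq_le: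
  assumes \<epsilon>: "\<epsilon> > 0"
  shows "(\<Sum>k<n. expectation (\<lambda>\<omega>. (\<eta> k \<omega>)\<^sup>2)) \<le> \<epsilon> * sqrt n + 3 * real n / \<epsilon>\<^sup>2"
proof -
  have "expectation (\<lambda>\<omega>. (\<eta> k \<omega>)\<^sup>2) \<le> \<epsilon> * (expectation (S (Suc k)) - expectation (S k)) + 3 / \<epsilon>\<^sup>2" for k
  proof -
    have b: "(\<eta> k \<omega>)\<^sup>2 \<le> \<epsilon> * (S (Suc k) \<omega> - S k \<omega>) + \<xi> k \<omega> ^ 4 / \<epsilon>\<^sup>2" for \<omega>
    proof (cases "\<eta> k \<omega> \<le> \<epsilon>")
      case True
      then have "(\<eta> k \<omega>)\<^sup>2 \<le> \<epsilon> * \<eta> k \<omega>" unfolding power2_eq_square by (intro mult_right_mono) auto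
      moreover have "S (Suc k) \<omega> - S k \<omega> = \<eta> k \<omega>" by simp
      moreover have "\<xi> k \<omega> ^ 4 / \<epsilon>\<^sup>2 \<ge> 0" by simp
      ultimately show ?thesis by (simp only:)
    next
      case False
      have "(\<eta> k \<omega>)\<^sup>2 * \<epsilon>\<^sup>2 \<le> (\<xi> k \<omega>)\<^sup>2 * (\<xi> k \<omega>)\<^sup>2"
      proof (rule mult_mono)
        have "\<epsilon>\<^sup>2 \<le> (\<eta> k \<omega>)\<^sup>2" using False \<epsilon> by (intro power_mono) auto
        then show "\<epsilon>\<^sup>2 \<le> (\<xi> k \<omega>)\<^sup>2" using \<eta>_sq_le[of k \<omega>] by simp
      qed (use \<eta>_sq_le in auto)
      also have "\<dots> = \<xi> k \<omega> ^ 4" by (simp flip: power_add)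
      finally have "(\<eta> k \<omega>)\<^sup>2 \<le> \<xi> k \<omega> ^ 4 / \<epsilon>\<^sup>2" using \<epsilon> by (simp add: pos_le_divide_eq)
      moreover have "\<epsilon> * (S (Suc k) \<omega> - S k \<omega>) \<ge> 0" using \<epsilon> by simp
      ultimately show ?thesis by linarith
    qed
    have "expectation (\<lambda>\<omega>. (\<eta> k \<omega>)\<^sup>2) \<le> expectation (\<lambda>\<omega>. \<epsilon> * (S (Suc k) \<omega> - S k \<omega>) + \<xi> k \<omega> ^ 4 / \<epsilon>\<^sup>2)"
      by (rule integral_mono[OF integrable_\<eta>_sq _ b])
         (intro Bochner_Integration.integrable_add integrable_mult_right Bochner_Integration.integrable_diff
            integrable_max integrable_divide \<xi>_moments)
    also have "\<dots> = \<epsilon> * (expectation (S (Suc k)) - expectation (S k)) + 3 / \<epsilon>\<^sup>2"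
      using integrable_max[of "Suc k"] integrable_max[of k] \<xi>_moments(1)[of k 4] \<xi>_moments(5)[of k]
      by (simp del: walk_max.simps)
    finally show ?thesis .
  qed
  then have "(\<Sum>k<n. expectation (\<lambda>\<omega>. (\<eta> k \<omega>)\<^sup>2))
     \<le> (\<Sum>k<n. \<epsilon> * (expectation (S (Suc k)) - expectation (S k)) + 3 / \<epsilon>\<^sup>2)"
    by (rule sum_mono)
  also have "\<dots> = \<epsilon> * (expectation (S n) - expectation (S 0)) + n * (3 / \<epsilon>\<^sup>2)"
    using sum_lessThan_telescope[of "\<lambda>k. expectation (S k)" n]
    by (simp add: sum.distrib sum_distrib_left[symmetric] del: walk_max.simps)
  also have "\<dots> \<le> \<epsilon> * sqrt n + 3 * real n / \<epsilon>\<^sup>2"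
    using mult_left_mono[OF expectation_max_le[of n], of \<epsilon>] \<epsilon> by (simp add: mult.commute)
  finally show ?thesis .
qed

section \<open>Discounted value along the walk\<close>

abbreviation rate :: "real \<Rightarrow> real \<Rightarrow> real \<Rightarrow> real \<Rightarrow> real" where
  "rate a l r s \<equiv> l + a * (r * s)"
text \<open>The walk always has unit steps and r enters by scaling: space scales by r and time by
  r^2, so the accumulated area scales by r^3.\<close>

abbreviation "discount a l r k \<omega> \<equiv> exp (- l * r\<^sup>2 * real k - a * r ^ 3 * A k \<omega>)"
abbreviation "val a l r k \<omega> \<equiv> value_fn a (rate a l r (S k \<omega>)) (r * D k \<omega>)"

lemma discount_le_1:
  assumes "a > 0" "l > 0" "r \<ge> 0"
  shows "discount a l r k \<omega> \<le> exp (- l * r\<^sup>2 * real k)" "discount a l r k \<omega> \<le> 1"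
proof -
  have "a * r ^ 3 * A k \<omega> \<ge> 0" "l * r\<^sup>2 * real k \<ge> 0" using assms walk_area_nonneg by auto
  then show "discount a l r k \<omega> \<le> exp (- l * r\<^sup>2 * real k)" "discount a l r k \<omega> \<le> 1"
    by (auto simp: minus_mult_left[symmetric] simp del: mult_minus_left)
qed

lemma discount_Suc:
  "discount a l r (Suc k) \<omega> = discount a l r k \<omega> * exp (- rate a l r (S k \<omega>) * r\<^sup>2)"
  unfolding exp_add[symmetric]
  by (simp add: walk_area_def algebra_simps power2_eq_square power3_eq_cube)

lemma rate_ge:
  assumes "a > 0" "r \<ge> 0"
  shows "rate a l r (S k \<omega>) \<ge> l"
  using assms walk_max_nonneg[of "\<lambda>i. \<xi> i \<omega>" k] by simp

lemma integrable_discount_val: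
  assumes "a > 0" "l > 0" "r \<ge> 0"
  shows "integrable M (\<lambda>\<omega>. discount a l r k \<omega> * val a l r k \<omega>)"
proof -
  obtain K where K: "K \<ge> 0" "\<And>\<mu> d. \<mu> \<ge> l \<Longrightarrow> d \<ge> 0 \<Longrightarrow> \<bar>value_fn a \<mu> d\<bar> \<le> K"
    using value_fn_bounded[OF assms(1,2)] by metis
  have "\<bar>discount a l r k \<omega>\<bar> * \<bar>val a l r k \<omega>\<bar> \<le> 1 * K" for \<omega>
    using discount_le_1(2)[OF assms, of k \<omega>] rate_ge[of a r l \<omega> k] assms walk_gap_nonneg[of "\<lambda>i. \<xi> i \<omega>" k]
    by (intro mult_mono K) auto
  then show ?thesis
    by (intro integrable_const_bound[where B=K]) (auto simp: abs_mult)
qed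

lemma integrable_discount:
  assumes "a > 0" "l > 0" "r \<ge> 0"
  shows "integrable M (discount a l r k)"
  by (intro integrable_const_bound[where B=1]) (use discount_le_1(2)[OF assms] in auto)

text \<open>\<open>one_step_estimate\<close> is applied at the random rate and gap and then
  averaged. The discount is at most 1 and is dropped from the error. The rate enters linearly, so
  the mean of the maximum suffices, and this is at most sqrt k.\<close>

lemma walk_one_step:
  assumes a: "a > 0" and l: "l > 0"
  obtains K where "K \<ge> 0"
    "\<And>r k. r \<ge> 0 \<Longrightarrow>
      \<bar>expectation (\<lambda>\<omega>. discount a l r (Suc k) \<omega> * val a l r (Suc k) \<omega>) + r\<^sup>2 * expectation (discount a l r k)
         - expectation (\<lambda>\<omega>. discount a l r k \<omega> * val a l r k \<omega>)\<bar>
       \<le> K * (r\<^sup>2 * expectation (\<lambda>\<omega>. (\<eta> k \<omega>)\<^sup>2) + rate a l r (sqrt k) * r ^ 4)"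
proof -
  obtain K where K: "K \<ge> 0"
    "\<And>\<mu> d r. \<mu> \<ge> l \<Longrightarrow> d \<ge> 0 \<Longrightarrow> r \<ge> 0 \<Longrightarrow>
      \<bar>exp (- \<mu> * r\<^sup>2) * (\<integral>z. value_fn a (\<mu> + a * (r * max 0 (z - d))) (r * max 0 (d - z)) \<partial>std_normal_measure)
         + r\<^sup>2 - value_fn a \<mu> (r * d)\<bar>
        \<le> K * (r\<^sup>2 * (\<integral>z. (max 0 (z - d))\<^sup>2 \<partial>std_normal_measure) + \<mu> * r ^ 4)"
    by (rule one_step_estimate[OF a l], erule that) blast
  show ?thesis
  proof (rule that[OF K(1)])
    fix r :: real and k assume r: "r \<ge> 0"
    define h where "h = (\<lambda>d s q z. exp (- l * r\<^sup>2 * real k - a * r ^ 3 * q) * exp (- rate a l r s * r\<^sup>2) *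
        value_fn a (rate a l r s + a * (r * max 0 (z - d))) (r * max 0 (d - z)))"
    let ?I = "\<lambda>\<omega>. \<integral>z. value_fn a (rate a l r (S k \<omega>) + a * (r * max 0 (z - D k \<omega>))) (r * max 0 (D k \<omega> - z)) \<partial>std_normal_measure"
    let ?m = "\<lambda>\<omega>. \<integral>z. (max 0 (z - D k \<omega>))\<^sup>2 \<partial>std_normal_measure"
    let ?e = "\<lambda>\<omega>. exp (- rate a l r (S k \<omega>) * r\<^sup>2)"
    have hS: "discount a l r (Suc k) \<omega> * val a l r (Suc k) \<omega> = h (D k \<omega>) (S k \<omega>) (A k \<omega>) (\<xi> k \<omega>)" for \<omega>
      unfolding h_def discount_Suc by (simp add: algebra_simps)
    have hm: "(\<lambda>((d, s, q), z). h d s q z) \<in> borel_measurable (borel :: ((real \<times> real \<times> real) \<times> real) measure)"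
      unfolding h_def case_prod_beta' borel_prod[symmetric] by measurable
    have hi: "integrable M (\<lambda>\<omega>. h (D k \<omega>) (S k \<omega>) (A k \<omega>) (\<xi> k \<omega>))"
      using integrable_discount_val[OF a l r, of "Suc k"] unfolding hS .
    have hI: "(\<integral>z. h (D k \<omega>) (S k \<omega>) (A k \<omega>) z \<partial>std_normal_measure) = discount a l r k \<omega> * (?e \<omega> * ?I \<omega>)" for \<omega>
      unfolding h_def by (simp add: mult.assoc)
    note h1 = expectation_step[OF hm hi, unfolded hI hS[symmetric]]
    have mm: "(\<lambda>((d, s, q), z). (max 0 (z - d))\<^sup>2) \<in> borel_measurable (borel :: ((real \<times> real \<times> real) \<times> real) measure)"
      unfolding case_prod_beta' borel_prod[symmetric] by measurable
    note m1 = expectation_step[OF mm integrable_\<eta>_sq]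
    let ?err = "\<lambda>\<omega>. ?e \<omega> * ?I \<omega> + r\<^sup>2 - val a l r k \<omega>"
    have eq: "expectation (\<lambda>\<omega>. discount a l r (Suc k) \<omega> * val a l r (Suc k) \<omega>) + r\<^sup>2 * expectation (discount a l r k)
         - expectation (\<lambda>\<omega>. discount a l r k \<omega> * val a l r k \<omega>) = expectation (\<lambda>\<omega>. discount a l r k \<omega> * ?err \<omega>)"
      (is "?L = _")
    proof -
      have "expectation (\<lambda>\<omega>. discount a l r k \<omega> * ?err \<omega>) = expectation (\<lambda>\<omega>. discount a l r k \<omega> * (?e \<omega> * ?I \<omega>)
         + r\<^sup>2 * discount a l r k \<omega> - discount a l r k \<omega> * val a l r k \<omega>)"
        by (intro Bochner_Integration.integral_cong) (auto simp: algebra_simps)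
      also have "\<dots> = ?L"
        using h1 integrable_discount[OF a l r, of k] integrable_discount_val[OF a l r, of k] by simp
      finally show ?thesis by simp
    qed
    have err: "\<bar>discount a l r k \<omega> * ?err \<omega>\<bar> \<le> K * (r\<^sup>2 * ?m \<omega> + rate a l r (S k \<omega>) * r ^ 4)" for \<omega>
    proof -
      have "\<bar>discount a l r k \<omega> * ?err \<omega>\<bar> \<le> 1 * \<bar>?err \<omega>\<bar>"
        unfolding abs_mult using discount_le_1(2)[OF a l r, of k \<omega>] by (intro mult_right_mono) auto
      also have "1 * \<bar>?err \<omega>\<bar> = \<bar>?err \<omega>\<bar>" by simp
      also have "\<bar>?err \<omega>\<bar> \<le> K * (r\<^sup>2 * ?m \<omega> + rate a l r (S k \<omega>) * r ^ 4)"
        using rate_ge[OF a r] walk_gap_nonneg r by (intro K(2)) auto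
      finally show ?thesis .
    qed
    have ib: "integrable M (\<lambda>\<omega>. K * (r\<^sup>2 * ?m \<omega> + rate a l r (S k \<omega>) * r ^ 4))"
      using m1(1) integrable_max[of k] by auto
    have "\<bar>?L\<bar> \<le> expectation (\<lambda>\<omega>. \<bar>discount a l r k \<omega> * ?err \<omega>\<bar>)"
      unfolding eq by (rule integral_abs_bound)
    also have "\<dots> \<le> expectation (\<lambda>\<omega>. K * (r\<^sup>2 * ?m \<omega> + rate a l r (S k \<omega>) * r ^ 4))"
      by (rule integral_mono_AE') (use err ib order.trans[OF abs_ge_zero err] in auto)
    also have "\<dots> = K * (r\<^sup>2 * expectation (\<lambda>\<omega>. (\<eta> k \<omega>)\<^sup>2) + rate a l r (expectation (S k)) * r ^ 4)"
      using m1 integrable_max[of k] by (simp add: prob_space)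
    also have "\<dots> \<le> K * (r\<^sup>2 * expectation (\<lambda>\<omega>. (\<eta> k \<omega>)\<^sup>2) + rate a l r (sqrt k) * r ^ 4)"
      using K a r expectation_max_le[of k] by (intro mult_left_mono add_left_mono mult_right_mono) auto
    finally show "\<bar>?L\<bar> \<le> K * (r\<^sup>2 * expectation (\<lambda>\<omega>. (\<eta> k \<omega>)\<^sup>2) + rate a l r (sqrt k) * r ^ 4)" .
  qed
qed

text \<open>The one-step identities telescope. The initial term is v at rate l and gap zero, that is
  u(l); the final term is bounded by the remaining discount times a bound for v. The truncation
  level eps stays free so that it can be tuned together with r and n.\<close>

lemma walk_telescoped:
  assumes a: "a > 0" and l: "l > 0"
  obtains K where "K \<ge> 0"
    "\<And>r n \<epsilon>. r \<ge> 0 \<Longrightarrow> \<epsilon> > 0 \<Longrightarrow>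
      \<bar>r\<^sup>2 * (\<Sum>k<n. expectation (discount a l r k)) - area_fn a l\<bar>
       \<le> K * (exp (- l * r\<^sup>2 * real n) + r\<^sup>2 * (\<epsilon> * sqrt n + 3 * real n / \<epsilon>\<^sup>2) + n * rate a l r (sqrt n) * r ^ 4)"
proof -
  obtain K0 where K0: "K0 \<ge> 0" "\<And>\<mu> d. \<mu> \<ge> l \<Longrightarrow> d \<ge> 0 \<Longrightarrow> \<bar>value_fn a \<mu> d\<bar> \<le> K0"
    using value_fn_bounded[OF assms(1,2)] by metis
  obtain K1 where K1: "K1 \<ge> 0"
    "\<And>r k. r \<ge> 0 \<Longrightarrow>
      \<bar>expectation (\<lambda>\<omega>. discount a l r (Suc k) \<omega> * val a l r (Suc k) \<omega>) + r\<^sup>2 * expectation (discount a l r k)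
         - expectation (\<lambda>\<omega>. discount a l r k \<omega> * val a l r k \<omega>)\<bar>
       \<le> K1 * (r\<^sup>2 * expectation (\<lambda>\<omega>. (\<eta> k \<omega>)\<^sup>2) + rate a l r (sqrt k) * r ^ 4)"
    by (rule walk_one_step[OF a l], erule that) blast
  show ?thesis
  proof (rule that[of "K0 + K1"])
    fix r \<epsilon> :: real and n :: nat assume r: "r \<ge> 0" and \<epsilon>: "\<epsilon> > 0"
    define U where "U = (\<lambda>k. expectation (\<lambda>\<omega>. discount a l r k \<omega> * val a l r k \<omega>))"
    define G where "G = (\<lambda>k. expectation (discount a l r k))"
    define E where "E = (\<lambda>k. expectation (\<lambda>\<omega>. (\<eta> k \<omega>)\<^sup>2))"
    have U0: "U 0 = area_fn a l"
      by (simp add: U_def walk_area_def value_fn_0 prob_space)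
    have "U n + r\<^sup>2 * (\<Sum>k<n. G k) - U 0 = (\<Sum>k<n. U (Suc k) - U k) + r\<^sup>2 * (\<Sum>k<n. G k)"
      by (simp add: sum_lessThan_telescope)
    also have "\<dots> = (\<Sum>k<n. U (Suc k) + r\<^sup>2 * G k - U k)"
      by (simp add: sum_distrib_left sum.distrib sum_subtractf)
    also have "\<bar>\<dots>\<bar> \<le> (\<Sum>k<n. \<bar>U (Suc k) + r\<^sup>2 * G k - U k\<bar>)" by (rule sum_abs)
    also have "\<dots> \<le> (\<Sum>k<n. K1 * (r\<^sup>2 * E k + rate a l r (sqrt n) * r ^ 4))"
    proof (rule sum_mono)
      fix k assume k: "k \<in> {..<n}"
      have "\<bar>U (Suc k) + r\<^sup>2 * G k - U k\<bar> \<le> K1 * (r\<^sup>2 * E k + rate a l r (sqrt k) * r ^ 4)"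
        unfolding U_def G_def E_def by (rule K1(2)[OF r])
      also have "\<dots> \<le> K1 * (r\<^sup>2 * E k + rate a l r (sqrt n) * r ^ 4)"
        using K1(1) a r k by (intro mult_left_mono add_left_mono mult_right_mono) auto
      finally show "\<bar>U (Suc k) + r\<^sup>2 * G k - U k\<bar> \<le> K1 * (r\<^sup>2 * E k + rate a l r (sqrt n) * r ^ 4)" .
    qed
    also have "\<dots> = K1 * (r\<^sup>2 * (\<Sum>k<n. E k) + n * rate a l r (sqrt n) * r ^ 4)"
      by (simp add: sum_distrib_left[symmetric] sum.distrib)
    also have "\<dots> \<le> K1 * (r\<^sup>2 * (\<epsilon> * sqrt n + 3 * real n / \<epsilon>\<^sup>2) + n * rate a l r (sqrt n) * r ^ 4)"
      unfolding E_def by (intro mult_left_mono add_right_mono sum_increment_sq_le \<epsilon> K1) auto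
    finally have 1: "\<bar>U n + r\<^sup>2 * (\<Sum>k<n. G k) - U 0\<bar>
       \<le> K1 * (r\<^sup>2 * (\<epsilon> * sqrt n + 3 * real n / \<epsilon>\<^sup>2) + n * rate a l r (sqrt n) * r ^ 4)" .
    have "\<bar>U n\<bar> \<le> expectation (\<lambda>\<omega>. \<bar>discount a l r n \<omega> * val a l r n \<omega>\<bar>)"
      unfolding U_def by (rule integral_abs_bound)
    also have "\<dots> \<le> expectation (\<lambda>\<omega>. exp (- l * r\<^sup>2 * real n) * K0)"
    proof (rule integral_mono)
      show "\<bar>discount a l r n \<omega> * val a l r n \<omega>\<bar> \<le> exp (- l * r\<^sup>2 * real n) * K0" for \<omega>
        unfolding abs_mult
        using discount_le_1(1)[OF a l r, of n \<omega>] rate_ge[of a r l \<omega> n] a r walk_gap_nonneg[of "\<lambda>i. \<xi> i \<omega>" n]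
        by (intro mult_mono K0) auto
    qed (use integrable_discount_val[OF a l r, of n] in auto)
    also have "\<dots> = K0 * exp (- l * r\<^sup>2 * real n)" by (simp add: prob_space)
    finally have 2: "\<bar>U n\<bar> \<le> K0 * exp (- l * r\<^sup>2 * real n)" .
    define P where "P = exp (- l * r\<^sup>2 * real n)"
    define Q where "Q = r\<^sup>2 * (\<epsilon> * sqrt n + 3 * real n / \<epsilon>\<^sup>2) + n * rate a l r (sqrt n) * r ^ 4"
    have "P \<ge> 0" "Q \<ge> 0" unfolding P_def Q_def using a l r \<epsilon> by auto
    then have "K0 * Q \<ge> 0" "K1 * P \<ge> 0" using K0 K1 by auto
    then have "\<bar>r\<^sup>2 * (\<Sum>k<n. G k) - area_fn a l\<bar> \<le> (K0 + K1) * (P + Q)"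
      using 1 2 unfolding P_def[symmetric] Q_def[symmetric] U0 by (simp add: algebra_simps)
    then show "\<bar>r\<^sup>2 * (\<Sum>k<n. expectation (discount a l r k)) - area_fn a l\<bar>
       \<le> (K0 + K1) * (exp (- l * r\<^sup>2 * real n) + r\<^sup>2 * (\<epsilon> * sqrt n + 3 * real n / \<epsilon>\<^sup>2) + n * rate a l r (sqrt n) * r ^ 4)"
      unfolding P_def Q_def G_def by (simp add: add.assoc)
  qed (use K0 K1 in auto)
qed

text \<open>The time step is \<open>h = m^-10\<close> and the horizon \<open>m^12 h = m^2\<close>; these powers make every error
  term vanish (with \<open>\<epsilon> = m^2\<close>) while keeping all exponents integral.\<close>

lemma walk_limit:
  assumes a: "a > 0" and l: "l > 0"
  shows "(\<lambda>m. 1 / real m ^ 10 * (\<Sum>k<m ^ 12. expectation (discount a l (1 / real m ^ 5) k))) \<longlonglongrightarrow> area_fn a l"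
proof -
  obtain K where K: "K \<ge> 0"
    "\<And>r n \<epsilon>. r \<ge> 0 \<Longrightarrow> \<epsilon> > 0 \<Longrightarrow>
      \<bar>r\<^sup>2 * (\<Sum>k<n. expectation (discount a l r k)) - area_fn a l\<bar>
       \<le> K * (exp (- l * r\<^sup>2 * real n) + r\<^sup>2 * (\<epsilon> * sqrt n + 3 * real n / \<epsilon>\<^sup>2) + n * rate a l r (sqrt n) * r ^ 4)"
    by (rule walk_telescoped[OF a l], erule that) blast
  \<comment> \<open>The summand 4 / m^2 collects r^2 eps sqrt n = m^(-2) and 3 r^2 n / eps^2 = 3
    m^(-2); the last one is n r^4 (l + a r sqrt n).\<close>
  define B where "B = (\<lambda>m::nat. K * (exp (- l * real m ^ 2) + 4 / real m ^ 2 + (l + a * real m) / real m ^ 8))"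
  have "B \<longlonglongrightarrow> 0" unfolding B_def using a l by real_asymp
  moreover have "eventually (\<lambda>m. norm (1 / real m ^ 10 * (\<Sum>k<m ^ 12. expectation (discount a l (1 / real m ^ 5) k)) - area_fn a l) \<le> B m) sequentially"
    using eventually_gt_at_top[of 0]
  proof eventually_elim
    case (elim m)
    define x where "x = real m"
    define r where "r = 1 / x ^ 5"
    have x: "x > 0" using elim by (simp add: x_def)
    have rr: "r\<^sup>2 = 1 / x ^ 10" "r ^ 4 = 1 / x ^ 20" by (auto simp: r_def power_divide simp flip: power_mult)
    have n: "real (m ^ 12) = x ^ 12" "sqrt (real (m ^ 12)) = x ^ 6"
      using x by (auto simp: x_def intro!: real_sqrt_unique simp flip: power_mult)
    have e1: "r\<^sup>2 * x ^ 12 = x ^ 2" using x unfolding rr by (simp flip: power_diff add: divide_simps power_add[symmetric])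
    then have e0: "- l * r\<^sup>2 * x ^ 12 = - l * x ^ 2" by (simp add: mult.assoc)
    have e2: "r\<^sup>2 * (x ^ 2 * x ^ 6 + 3 * x ^ 12 / (x\<^sup>2)\<^sup>2) = 4 / x ^ 2"
      using x unfolding rr by (simp add: divide_simps flip: power_add power_mult)
    have e3: "x ^ 12 * (l + a * (r * x ^ 6)) * r ^ 4 = (l + a * x) / x ^ 8"
    proof -
      have "r * x ^ 6 = x" using x power_add[of x 1 5] unfolding r_def by simp
      moreover have "x ^ 12 * r ^ 4 = 1 / x ^ 8" using x unfolding rr by (simp add: divide_simps flip: power_add)
      ultimately show ?thesis by (simp add: mult.assoc mult.commute mult.left_commute)
    qed
    have "\<bar>r\<^sup>2 * (\<Sum>k<m ^ 12. expectation (discount a l r k)) - area_fn a l\<bar>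
       \<le> K * (exp (- l * r\<^sup>2 * x ^ 12) + r\<^sup>2 * (x ^ 2 * x ^ 6 + 3 * x ^ 12 / (x\<^sup>2)\<^sup>2) + x ^ 12 * (l + a * (r * x ^ 6)) * r ^ 4)"
    proof -
      have "r \<ge> 0" "x ^ 2 > 0" using x by (auto simp: r_def)
      from K(2)[OF this, of "m ^ 12", unfolded n(2), unfolded n(1)] show ?thesis .
    qed
    also have "\<dots> = B m" by (simp only: e0 e2 e3 B_def x_def[symmetric])
    finally have "\<bar>r\<^sup>2 * (\<Sum>k<m ^ 12. expectation (discount a l r k)) - area_fn a l\<bar> \<le> B m" .
    moreover have "1 / real m ^ 10 = r\<^sup>2" "1 / real m ^ 5 = r" using rr(1) by (auto simp: x_def r_def)
    ultimately show ?case by (simp only: real_norm_def)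
  qed
  ultimately have "(\<lambda>m. 1 / real m ^ 10 * (\<Sum>k<m ^ 12. expectation (discount a l (1 / real m ^ 5) k)) - area_fn a l) \<longlonglongrightarrow> 0"
    by (rule Lim_null_comparison[rotated])
  then show ?thesis by (simp add: LIM_zero_iff)
qed

end

section \<open>From the walk to Brownian motion\<close>

text \<open>In both cases the first k steps have the product law, and the area is a function of
  them. Applied to increments of one Brownian motion at two mesh sizes, this is Brownian scaling in
  discrete form.\<close>

lemma iid_normal_walk_area_law:
  fixes g :: "real \<Rightarrow> real"
  assumes "iid_normal M \<xi>" "iid_normal M \<zeta>" and g: "g \<in> borel_measurable borel"
  shows "(\<integral>\<omega>. g (walk_area (\<lambda>i. \<xi> i \<omega>) k) \<partial>M) = (\<integral>\<omega>. g (walk_area (\<lambda>i. \<zeta> i \<omega>) k) \<partial>M)"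
proof (cases "k = 0")
  case False
  then have ne: "{..<k} \<noteq> {}" by auto
  let ?P = "PiM {..<k} (\<lambda>_. borel :: real measure)"
  have gm: "(\<lambda>x. g (walk_area x k)) \<in> borel_measurable ?P"
    by (rule measurable_compose[OF _ g]) (auto intro!: measurable_walk_area)
  have *: "(\<integral>\<omega>. g (walk_area (\<lambda>i. X i \<omega>) k) \<partial>M)
      = (\<integral>x. g (walk_area x k) \<partial>PiM {..<k} (\<lambda>_. std_normal_measure))" if "iid_normal M X" for X
  proof -
    interpret iid_normal M X by fact
    have "(\<integral>\<omega>. g (walk_area (\<lambda>i. X i \<omega>) k) \<partial>M) = (\<integral>\<omega>. g (walk_area (\<lambda>i\<in>{..<k}. X i \<omega>) k) \<partial>M)"
      by (intro Bochner_Integration.integral_cong arg_cong[where f=g] walk_area_cong) auto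
    also have "\<dots> = (\<integral>x. g (walk_area x k) \<partial>distr M ?P (\<lambda>\<omega>. \<lambda>i\<in>{..<k}. X i \<omega>))"
      using gm by (subst integral_distr) auto
    also have "distr M ?P (\<lambda>\<omega>. \<lambda>i\<in>{..<k}. X i \<omega>) = PiM {..<k} (\<lambda>_. std_normal_measure)"
      using indep_vars_iff_distr_eq_PiM'[OF ne, where M'="\<lambda>_. borel" and X=X] indep[of k] by (simp add: law)
    finally show ?thesis .
  qed
  show ?thesis using *[OF assms(1)] *[OF assms(2)] by simp
qed (simp add: walk_area_def)

definition scaled_increment :: "(real \<Rightarrow> 'a \<Rightarrow> real) \<Rightarrow> real \<Rightarrow> nat \<Rightarrow> 'a \<Rightarrow> real" where
  "scaled_increment B h i \<omega> = (B (real (Suc i) * h) \<omega> - B (real i * h) \<omega>) / sqrt h"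

lemma brownian_increments_iid:
  assumes bm: "standard_brownian_motion M B" and h: "h > 0"
  shows "iid_normal M (scaled_increment B h)"
proof -
  interpret prob_space M using bm by (simp add: standard_brownian_motion_def)
  show ?thesis
  proof
    fix n
    have "strict_mono (\<lambda>i. real i * h)" using h by (auto simp: strict_mono_def)
    then have "indep_vars (\<lambda>_. borel) (\<lambda>i \<omega>. B (real (Suc i) * h) \<omega> - B (real i * h) \<omega>) {..<n}"
      using bm unfolding standard_brownian_motion_def
      by (elim conjE) (drule spec[of _ "\<lambda>i. real i * h"], simp)
    then show "indep_vars (\<lambda>_. borel) (scaled_increment B h) {..<n}"
      unfolding scaled_increment_def[abs_def] by (rule indep_vars_compose2) auto
  next
    fix k
    have "distributed M lborel (\<lambda>\<omega>. B (real (Suc k) * h) \<omega> - B (real k * h) \<omega>)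
        (\<lambda>x. ennreal (normal_density 0 (sqrt (real (Suc k) * h - real k * h)) x))"
      using bm h unfolding standard_brownian_motion_def by (elim conjE) (simp add: mult_strict_right_mono)
    then have "distributed M lborel (\<lambda>\<omega>. B (real (Suc k) * h) \<omega> - B (real k * h) \<omega>) (\<lambda>x. ennreal (normal_density 0 (sqrt h) x))"
      by (simp add: algebra_simps)
    then have "distributed M lborel (scaled_increment B h k) (\<lambda>x. ennreal (std_normal_density x))"
      using h by (subst (asm) normal_standard_normal_convert) (auto simp: scaled_increment_def[abs_def])
    then have "distr M lborel (scaled_increment B h k) = std_normal_measure"
      unfolding std_normal_measure_def by (simp add: distributed_distr_eq_density)
    moreover have "distr M borel (scaled_increment B h k) = distr M lborel (scaled_increment B h k)"
      by (intro distr_cong) auto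
    ultimately show "distr M borel (scaled_increment B h k) = std_normal_measure" by simp
  qed
qed

text \<open>This turns a Riemann sum into the integral of a step function, so that dominated
  convergence applies. It serves twice: for the area over [0,1] and for the outer integral over
  time.\<close>

lemma has_bochner_integral_step:
  fixes f :: "nat \<Rightarrow> real"
  assumes h: "h > 0"
  shows "has_bochner_integral lborel (\<lambda>t. indicator {0..<real n * h} t * f (nat \<lfloor>t / h\<rfloor>)) (h * (\<Sum>k<n. f k))"
proof -
  have "has_bochner_integral lborel (\<lambda>t. \<Sum>k<n. indicator {real k * h..<real (Suc k) * h} t * f k)
      (\<Sum>k<n. (real (Suc k) * h - real k * h) * f k)"
    using h by (intro has_bochner_integral_sum has_bochner_integral_mult_left)
      (auto simp: has_bochner_integral_iff mult_right_mono intro!: integrable_real_indicator)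
  also have "(\<lambda>t. \<Sum>k<n. indicator {real k * h..<real (Suc k) * h} t * f k)
     = (\<lambda>t. indicator {0..<real n * h} t * f (nat \<lfloor>t / h\<rfloor>))"
  proof
    fix t :: real
    \<comment> \<open>The cells are half-open, so each t >= 0 lies in exactly one and the sum
      collapses to a single term.\<close>
    have *: "t \<in> {real k * h..<real (Suc k) * h} \<longleftrightarrow> 0 \<le> t \<and> nat \<lfloor>t / h\<rfloor> = k" for k
    proof -
      have "t \<in> {real k * h..<real (Suc k) * h} \<longleftrightarrow> real k \<le> t / h \<and> t / h < real k + 1"
        using h by (simp add: field_simps)
      also have "\<dots> \<longleftrightarrow> \<lfloor>t / h\<rfloor> = int k" by (simp add: floor_eq_iff)
      also have "\<dots> \<longleftrightarrow> 0 \<le> \<lfloor>t / h\<rfloor> \<and> nat \<lfloor>t / h\<rfloor> = k"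
        by (auto simp del: zero_le_floor)
      also have "0 \<le> \<lfloor>t / h\<rfloor> \<longleftrightarrow> 0 \<le> t" using h by (simp add: zero_le_divide_iff)
      finally show ?thesis .
    qed
    have "(\<Sum>k<n. indicator {real k * h..<real (Suc k) * h} t * f k) = (\<Sum>k<n. if k = nat \<lfloor>t / h\<rfloor> then of_bool (0 \<le> t) * f k else 0)"
      unfolding indicator_def * by (intro sum.cong refl) auto
    also have "\<dots> = of_bool (0 \<le> t \<and> nat \<lfloor>t / h\<rfloor> < n) * f (nat \<lfloor>t / h\<rfloor>)"
      by (simp add: sum.delta)
    also have "0 \<le> t \<and> nat \<lfloor>t / h\<rfloor> < n \<longleftrightarrow> t \<in> {0..<real n * h}"
    proof -
      have "nat \<lfloor>t / h\<rfloor> < n \<longleftrightarrow> t < real n * h" if "0 \<le> t"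
      proof -
        have "nat \<lfloor>t / h\<rfloor> < n \<longleftrightarrow> \<lfloor>t / h\<rfloor> < int n" using that h by (simp add: nat_less_iff)
        also have "\<dots> \<longleftrightarrow> t < real n * h" using h by (simp add: floor_less_iff pos_divide_less_eq)
        finally show ?thesis .
      qed
      then show ?thesis by auto
    qed
    finally show "(\<Sum>k<n. indicator {real k * h..<real (Suc k) * h} t * f k) = indicator {0..<real n * h} t * f (nat \<lfloor>t / h\<rfloor>)"
      by (simp add: indicator_def)
  qed
  also have "(\<Sum>k<n. (real (Suc k) * h - real k * h) * f k) = h * (\<Sum>k<n. f k)"
    by (simp add: sum_distrib_left algebra_simps)
  finally show ?thesis .
qed

lemma floor_grid_tendsto:
  fixes s :: real
  assumes "s \<ge> 0" "filterlim X at_top F"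
  shows "((\<lambda>k. real (nat \<lfloor>s * X k\<rfloor>) / X k) \<longlongrightarrow> s) F"
proof -
  have ev: "eventually (\<lambda>k. X k > 0) F" using assms(2) by (simp add: filterlim_at_top_dense)
  have lim: "((\<lambda>k. s - 1 / X k) \<longlongrightarrow> s - 0) F"
    by (intro tendsto_diff tendsto_const tendsto_divide_0[OF tendsto_const] filterlim_at_top_imp_at_infinity assms)
  show ?thesis
  proof (rule tendsto_sandwich[where f="\<lambda>k. s - 1 / X k" and h="\<lambda>_. s"])
    show "eventually (\<lambda>k. s - 1 / X k \<le> real (nat \<lfloor>s * X k\<rfloor>) / X k) F"
      using ev
    proof eventually_elim
      case (elim k)
      have "s * X k - 1 \<le> real (nat \<lfloor>s * X k\<rfloor>)" by linarith
      then have "(s * X k - 1) / X k \<le> real (nat \<lfloor>s * X k\<rfloor>) / X k"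
        using elim by (intro divide_right_mono) auto
      then show ?case using elim by (simp add: diff_divide_distrib)
    qed
    show "eventually (\<lambda>k. real (nat \<lfloor>s * X k\<rfloor>) / X k \<le> s) F"
      using ev
    proof eventually_elim
      case (elim k)
      have "real (nat \<lfloor>s * X k\<rfloor>) \<le> s * X k" using elim assms(1) by simp
      then show ?case using elim by (simp add: field_simps)
    qed
  qed (use lim in auto)
qed

section \<open>Convergence of the grid maximum and its area along a continuous path\<close>

context
  fixes b :: "real \<Rightarrow> real"
  assumes b0: "b 0 = 0" and cont: "continuous_on {0..} b"
begin

abbreviation "grid_increment k i \<equiv> b (real (Suc i) / real k) - b (real i / real k)"
abbreviation "running_sup t \<equiv> Sup (b ` {0..t})"

lemma running_sup_attained:
  assumes "t \<ge> 0"
  obtains s where "0 \<le> s" "s \<le> t" "running_sup t = b s" "\<And>u. 0 \<le> u \<Longrightarrow> u \<le> t \<Longrightarrow> b u \<le> b s"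
proof -
  have "continuous_on {0..t} b" by (rule continuous_on_subset[OF cont]) auto
  then obtain s where s: "s \<in> {0..t}" "\<forall>u\<in>{0..t}. b u \<le> b s"
    using continuous_attains_sup[of "{0..t}" b] assms by auto
  then have "running_sup t = b s" by (intro cSup_eq_maximum) auto
  with s that show ?thesis by auto
qed

lemma grid_max_le:
  assumes "k > 0" "t \<ge> 0"
  shows "walk_max (grid_increment k) (nat \<lfloor>t * real k\<rfloor>) \<le> running_sup t"
proof -
  obtain j where j: "j \<le> nat \<lfloor>t * real k\<rfloor>" "walk_max (grid_increment k) (nat \<lfloor>t * real k\<rfloor>) = (\<Sum>i<j. grid_increment k i)"
    using walk_max_attained by blast
  have "(\<Sum>i<j. grid_increment k i) = b (real j / real k)"
    using sum_lessThan_telescope[of "\<lambda>i. b (real i / real k)" j] b0 by simp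
  moreover have "real j / real k \<le> t"
  proof -
    have "real j \<le> t * real k" using j(1) assms by (simp add: le_nat_iff le_floor_iff)
    then show ?thesis using assms by (simp add: field_simps)
  qed
  ultimately show ?thesis using j(2) running_sup_attained[OF assms(2)] by (metis divide_nonneg_nonneg of_nat_0_le_iff)
qed

text \<open>From above, the grid points used lie in [0,t]. From below, take a maximiser s and the
  last grid point not exceeding s; by continuity the path there tends to its value at s.\<close>

lemma grid_max_tendsto:
  assumes "t \<ge> 0"
  shows "(\<lambda>k. walk_max (grid_increment k) (nat \<lfloor>t * real k\<rfloor>)) \<longlonglongrightarrow> running_sup t"
proof -
  obtain s where s: "0 \<le> s" "s \<le> t" "running_sup t = b s"
    using running_sup_attained[OF assms] by metis
  have "(\<lambda>k. real (nat \<lfloor>s * real k\<rfloor>) / real k) \<longlonglongrightarrow> s"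
    using s(1) by (intro floor_grid_tendsto filterlim_real_sequentially)
  then have lim: "(\<lambda>k. b (real (nat \<lfloor>s * real k\<rfloor>) / real k)) \<longlonglongrightarrow> b s"
    using cont s(1) by (intro continuous_on_tendsto_compose[OF cont]) auto
  show ?thesis
  proof (rule tendsto_sandwich[OF _ _ lim[folded s(3)] tendsto_const])
    show "eventually (\<lambda>k. b (real (nat \<lfloor>s * real k\<rfloor>) / real k) \<le> walk_max (grid_increment k) (nat \<lfloor>t * real k\<rfloor>)) sequentially"
    proof (intro always_eventually allI)
      fix k
      have "nat \<lfloor>s * real k\<rfloor> \<le> nat \<lfloor>t * real k\<rfloor>"
        using s by (intro nat_mono floor_mono mult_right_mono) auto
      then have "(\<Sum>i<nat \<lfloor>s * real k\<rfloor>. grid_increment k i) \<le> walk_max (grid_increment k) (nat \<lfloor>t * real k\<rfloor>)"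
        by (rule partial_sum_le_walk_max)
      then show "b (real (nat \<lfloor>s * real k\<rfloor>) / real k) \<le> walk_max (grid_increment k) (nat \<lfloor>t * real k\<rfloor>)"
        using sum_lessThan_telescope[of "\<lambda>i. b (real i / real k)" "nat \<lfloor>s * real k\<rfloor>"] b0 by simp
    qed
    show "eventually (\<lambda>k. walk_max (grid_increment k) (nat \<lfloor>t * real k\<rfloor>) \<le> running_sup t) sequentially"
      using eventually_gt_at_top[of 0] by eventually_elim (use grid_max_le assms in auto)
  qed
qed

text \<open>Dominated convergence for the step functions, with the maximum of the path over [0,1] as
  the dominating constant.\<close>

lemma grid_area_tendsto:
  "(\<lambda>k. walk_area (grid_increment k) k / real k) \<longlonglongrightarrow> (LBINT t=0..1. running_sup t)"
proof -
  define s where "s = (\<lambda>k t. indicator {0..<1} t * walk_max (grid_increment k) (nat \<lfloor>t * real k\<rfloor>))"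
  define f where "f = (\<lambda>t. indicator {0..<1} t * running_sup t)"
  obtain u where u: "0 \<le> u" "running_sup 1 = b u" "\<And>v. 0 \<le> v \<Longrightarrow> v \<le> 1 \<Longrightarrow> b v \<le> b u"
    by (rule running_sup_attained[OF zero_le_one]) blast
  have s: "has_bochner_integral lborel (s k) (walk_area (grid_increment k) k / real k)" if "k > 0" for k
    using has_bochner_integral_step[of "1 / real k" k "walk_max (grid_increment k)"] that
    unfolding s_def walk_area_def by simp
  have lim: "(\<lambda>k. s k t) \<longlonglongrightarrow> f t" for t
    unfolding s_def f_def by (cases "t \<in> {0..<1}") (use grid_max_tendsto[of t] in \<open>auto simp del: of_nat_Suc\<close>)
  \<comment> \<open>The integral of \<open>s k\<close> is known only for positive k, hence the index
    \<open>Suc k\<close>. Measurability of the limit is inherited from these step functions.\<close>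
  have sm [measurable]: "s (Suc k) \<in> borel_measurable lborel" for k
    using s[of "Suc k"] by (auto simp: has_bochner_integral_iff)
  have fm [measurable]: "f \<in> borel_measurable lborel"
    by (rule borel_measurable_LIMSEQ_real[where u="\<lambda>k. s (Suc k)"]) (use LIMSEQ_Suc[OF lim] in auto)
  have "(\<lambda>k. integral\<^sup>L lborel (s (Suc k))) \<longlonglongrightarrow> integral\<^sup>L lborel f"
  proof (rule integral_dominated_convergence[where w="\<lambda>t. indicator {0..<1} t * b u"])
    show "integrable lborel (\<lambda>t::real. indicator {0..<1} t * b u)"
      by (intro integrable_mult_left integrable_real_indicator) auto
    show "AE t in lborel. (\<lambda>k. s (Suc k) t) \<longlonglongrightarrow> f t"
      using LIMSEQ_Suc[OF lim] by simp
    fix k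
    show "AE t in lborel. norm (s (Suc k) t) \<le> indicator {0..<1} t * b u"
    proof (intro AE_I2)
      fix t :: real
      show "norm (s (Suc k) t) \<le> indicator {0..<1} t * b u"
      proof (cases "t \<in> {0..<1}")
        case True
        have "walk_max (grid_increment (Suc k)) (nat \<lfloor>t * real (Suc k)\<rfloor>) \<le> running_sup t"
          using True by (intro grid_max_le) auto
        also have "\<dots> \<le> b u" using running_sup_attained[of t] u(3) True by force
        finally show ?thesis using True walk_max_nonneg[of "grid_increment (Suc k)"] by (simp add: s_def)
      qed (simp add: s_def)
    qed
  qed simp_all
  \<comment> \<open>The interval integral runs over the open interval, which differs from the
    half-open one by a null set.\<close>
  also have "integral\<^sup>L lborel f = (LBINT t:{0<..<1}. running_sup t)"
    unfolding set_lebesgue_integral_def f_def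
  proof (rule integral_cong_AE)
    show "AE t in lborel. indicator {0..<1} t * running_sup t = indicator {0<..<1} t *\<^sub>R running_sup t"
      by (rule AE_I[where N="{0}"]) (auto simp: indicator_def)
    have "(\<lambda>t. indicator {0<..<1} t *\<^sub>R running_sup t) = (\<lambda>t. indicator {0<..} t * f t)"
      by (auto simp: f_def indicator_def fun_eq_iff)
    then show "(\<lambda>t. indicator {0<..<1} t *\<^sub>R running_sup t) \<in> borel_measurable lborel" by simp
    show "(\<lambda>t. indicator {0..<1} t * running_sup t) \<in> borel_measurable lborel"
      using fm unfolding f_def .
  qed
  also have "\<dots> = (LBINT t=0..1. running_sup t)"
    by (simp add: interval_lebesgue_integral_def zero_ereal_def one_ereal_def)
  finally have "(\<lambda>k. integral\<^sup>L lborel (s (Suc k))) \<longlonglongrightarrow> (LBINT t=0..1. running_sup t)" .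
  then have "(\<lambda>k. walk_area (grid_increment (Suc k)) (Suc k) / real (Suc k)) \<longlonglongrightarrow> (LBINT t=0..1. running_sup t)"
    using s by (simp add: has_bochner_integral_iff)
  then show ?thesis by (rule LIMSEQ_imp_Suc)
qed

end

section \<open>Brownian scaling and the passage to the limit\<close>

definition grid_area :: "(real \<Rightarrow> 'a \<Rightarrow> real) \<Rightarrow> nat \<Rightarrow> 'a \<Rightarrow> real" where
  "grid_area B k \<omega> = walk_area (\<lambda>i. B (real (Suc i) / real k) \<omega> - B (real i / real k) \<omega>) k / real k"

lemma grid_area_nonneg: "grid_area B k \<omega> \<ge> 0"
  by (simp add: grid_area_def walk_area_nonneg)

lemma grid_area_tendsto_sup_area:
  assumes "standard_brownian_motion M B" "\<omega> \<in> space M"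
  shows "(\<lambda>k. grid_area B k \<omega>) \<longlonglongrightarrow> sup_area B \<omega>"
  using assms grid_area_tendsto[of "\<lambda>t. B t \<omega>"]
  unfolding standard_brownian_motion_def grid_area_def sup_area_def sup_process_def by simp

text \<open>Undoing the mesh 1/k gives a factor k, and normalising the increments gives sqrt k.
  Together they produce the exponent 3/2 of the theorem.\<close>

lemma grid_area_scaled:
  "walk_area (\<lambda>i. scaled_increment B (1 / real k) i \<omega>) k = real k * sqrt (real k) * grid_area B k \<omega>"
proof (cases "k = 0")
  case False
  have "scaled_increment B (1 / real k) i \<omega> = sqrt (real k) * (B (real (Suc i) / real k) \<omega> - B (real i / real k) \<omega>)" for i
    by (simp add: scaled_increment_def real_sqrt_divide mult.commute del: of_nat_Suc)
  then have "walk_area (\<lambda>i. scaled_increment B (1 / real k) i \<omega>) k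
     = sqrt (real k) * walk_area (\<lambda>i. B (real (Suc i) / real k) \<omega> - B (real i / real k) \<omega>) k"
    by (simp only: walk_area_scale real_sqrt_ge_zero of_nat_0_le_iff)
  then show ?thesis using False unfolding grid_area_def by simp
qed (simp add: walk_area_def)

lemma measurable_grid_area:
  assumes bm: "standard_brownian_motion M B"
  shows "grid_area B k \<in> borel_measurable M"
proof (cases "k = 0")
  case False
  interpret iid_normal M "scaled_increment B (1 / real k)"
    using False by (intro brownian_increments_iid[OF bm]) auto
  have "grid_area B k = (\<lambda>\<omega>. walk_area (\<lambda>i. scaled_increment B (1 / real k) i \<omega>) k / (real k * sqrt (real k)))"
    using False by (auto simp: grid_area_scaled fun_eq_iff)
  then show ?thesis by simp
qed (simp add: grid_area_def[abs_def])

text \<open>The k-step area of the unit-mesh walk is replaced in law by a rescaled Riemann sum over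
  [0,1] with k cells. The latter converges along each path as k grows.\<close>

lemma expectation_walk_area_eq_grid_area:
  assumes bm: "standard_brownian_motion M B" and \<theta>: "\<theta> \<ge> 0"
  shows "(\<integral>\<omega>. exp (- \<theta> * walk_area (\<lambda>i. scaled_increment B 1 i \<omega>) k) \<partial>M)
       = (\<integral>\<omega>. exp (- (\<theta> * (real k * sqrt (real k))) * grid_area B k \<omega>) \<partial>M)"
proof (cases "k = 0")
  case False
  have "(\<integral>\<omega>. exp (- \<theta> * walk_area (\<lambda>i. scaled_increment B 1 i \<omega>) k) \<partial>M)
      = (\<integral>\<omega>. exp (- \<theta> * walk_area (\<lambda>i. scaled_increment B (1 / real k) i \<omega>) k) \<partial>M)"
    using False by (intro iid_normal_walk_area_law brownian_increments_iid[OF bm]) auto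
  then show ?thesis by (simp add: grid_area_scaled mult.assoc)
qed (simp add: walk_area_def)

text \<open>One limit is computed twice. The discounted sums of the walk tend to
  \<open>area_fn a l\<close> by \<open>walk_limit\<close>. They are also integrals of step functions
  in time that converge, under an integrable bound, to the integrand on the left.\<close>

theorem theorem1:
  fixes M :: "'a measure" and B :: "real \<Rightarrow> 'a \<Rightarrow> real" and a l :: real
  assumes "standard_brownian_motion M B" and "a > 0" and "l > 0"
  defines "\<psi> \<equiv> (\<lambda>s::real. prob_space.expectation M (\<lambda>\<omega>. exp (- s * sup_area B \<omega>)))"
  shows "(LBINT s:{0..}. \<psi> (a * s powr (3/2)) * exp (- l * s))
       = (LBINT s:{0..}. (1 + 3 * a * s / (2 * sqrt (2 * l))) powr (-2/3) * exp (- l * s))"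
proof -
  note bm = assms(1) and a = assms(2) and l = assms(3)
  interpret iid_normal M "scaled_increment B 1" by (rule brownian_increments_iid[OF bm]) simp
  note [measurable] = measurable_grid_area[OF bm]
  have area_lim: "(\<lambda>k. grid_area B k \<omega>) \<longlonglongrightarrow> sup_area B \<omega>" if "\<omega> \<in> space M" for \<omega>
    by (rule grid_area_tendsto_sup_area[OF bm that])
  have [measurable]: "sup_area B \<in> borel_measurable M"
    by (rule borel_measurable_LIMSEQ_real[OF area_lim]) auto
  define \<Phi> where "\<Phi> = (\<lambda>x k. expectation (\<lambda>\<omega>. exp (- (a * x powr (3/2)) * grid_area B k \<omega>)))"
  define F where "F = (\<lambda>m k. expectation (discount a l (1 / real m ^ 5) k))"
  have \<Phi>_bound: "\<bar>\<Phi> x k\<bar> \<le> 1" for x k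
  proof -
    have "\<bar>\<Phi> x k\<bar> \<le> expectation (\<lambda>\<omega>. \<bar>exp (- (a * x powr (3/2)) * grid_area B k \<omega>)\<bar>)"
      unfolding \<Phi>_def by (rule integral_abs_bound)
    also have "\<dots> \<le> expectation (\<lambda>\<omega>. 1)"
      using a by (intro integral_mono_AE') (auto simp: grid_area_nonneg)
    finally show ?thesis by (simp add: prob_space)
  qed
  \<comment> \<open>Step k happens at time x = k r^2, and r^3 k^(3/2) = x^(3/2). So the area factor
    of the discount depends on r only through x.\<close>
  have F_eq: "F m k = exp (- l * (real k / real m ^ 10)) * \<Phi> (real k / real m ^ 10) k" if m: "m > 0" for m k
  proof -
    define r where "r = 1 / real m ^ 5"
    have r: "r > 0" using m by (simp add: r_def)
    have r2: "real k / real m ^ 10 = real k * r\<^sup>2" by (simp add: r_def power_divide flip: power_mult)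
    have "(real k * r\<^sup>2) powr (3/2) = (real k * r\<^sup>2) * sqrt (real k * r\<^sup>2)"
      using r powr_add[of "real k * r\<^sup>2" 1 "1/2"] by (cases "k = 0") (auto simp: powr_half_sqrt)
    also have "\<dots> = r ^ 3 * (real k * sqrt (real k))"
      using r by (simp add: real_sqrt_mult power2_eq_square power3_eq_cube)
    finally have pw: "a * (real k * r\<^sup>2) powr (3/2) = a * r ^ 3 * (real k * sqrt (real k))" by simp
    have "F m k = expectation (\<lambda>\<omega>. exp (- l * r\<^sup>2 * real k) * exp (- (a * r ^ 3) * walk_area (\<lambda>i. scaled_increment B 1 i \<omega>) k))"
      unfolding F_def r_def[symmetric] exp_add[symmetric] by simp
    also have "\<dots> = exp (- l * r\<^sup>2 * real k) * expectation (\<lambda>\<omega>. exp (- (a * r ^ 3) * walk_area (\<lambda>i. scaled_increment B 1 i \<omega>) k))"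
      by (rule integral_mult_right_zero)
    also have "\<dots> = exp (- l * r\<^sup>2 * real k) * \<Phi> (real k * r\<^sup>2) k"
      using a r unfolding \<Phi>_def pw by (subst expectation_walk_area_eq_grid_area[OF bm]) auto
    finally show ?thesis unfolding r2 by (simp add: mult_ac)
  qed
  define s where "s = (\<lambda>m t. indicator {0..<real (m ^ 12) * (1 / real m ^ 10)} t * F m (nat \<lfloor>t / (1 / real m ^ 10)\<rfloor>))"
  define f where "f = (\<lambda>t. indicator {0..} t *\<^sub>R (\<psi> (a * t powr (3/2)) * exp (- l * t)))"
  have s: "has_bochner_integral lborel (s m) (1 / real m ^ 10 * (\<Sum>k<m ^ 12. F m k))" if "m > 0" for m
    unfolding s_def using that by (intro has_bochner_integral_step) auto
  have lim: "(\<lambda>m. s m t) \<longlonglongrightarrow> f t" for t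
  proof (cases "t \<ge> 0")
    case True
    define k where "k = (\<lambda>m. nat \<lfloor>t * real m ^ 10\<rfloor>)"
    define x where "x = (\<lambda>m. real (k m) / real m ^ 10)"
    have m10: "filterlim (\<lambda>m. real m ^ 10) at_top sequentially" by real_asymp
    have x: "x \<longlonglongrightarrow> t" unfolding x_def k_def by (rule floor_grid_tendsto[OF True m10])
    have \<Phi>: "(\<lambda>m. \<Phi> (x m) (k m)) \<longlonglongrightarrow> \<psi> (a * t powr (3/2))"
    \<comment> \<open>At t = 0 the step count stays 0 and the grid never refines, but there both
      sides are expectations of the constant 1.\<close>
    proof (cases "t = 0")
      case True
      then show ?thesis by (simp add: k_def x_def \<Phi>_def \<psi>_def)
    next
      case False
      then have t: "t > 0" using True by simp
      have k: "filterlim k at_top sequentially"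
        unfolding k_def using t
        by (intro filterlim_compose[OF filterlim_nat_sequentially] filterlim_compose[OF filterlim_floor_sequentially]
              filterlim_tendsto_pos_mult_at_top[OF tendsto_const _ m10])
      show ?thesis
        unfolding \<Phi>_def \<psi>_def
      proof (rule integral_dominated_convergence[where w="\<lambda>_. 1"])
        show "AE \<omega> in M. (\<lambda>m. exp (- (a * x m powr (3/2)) * grid_area B (k m) \<omega>))
            \<longlonglongrightarrow> exp (- (a * t powr (3/2)) * sup_area B \<omega>)"
          using t by (intro AE_I2 tendsto_intros x filterlim_compose[OF area_lim k]) auto
        show "AE \<omega> in M. norm (exp (- (a * x m powr (3/2)) * grid_area B (k m) \<omega>)) \<le> 1" for m
          using a by (auto simp: grid_area_nonneg)
      qed auto
    qed
    \<comment> \<open>The horizon of \<open>s m\<close> is m^2, so its indicator is eventually 1 at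
      any fixed t >= 0.\<close>
    have "eventually (\<lambda>m. exp (- l * x m) * \<Phi> (x m) (k m) = s m t) sequentially"
    proof -
      have "filterlim (\<lambda>m::nat. real m ^ 2) at_top sequentially" by real_asymp
      then have "eventually (\<lambda>m::nat. t < real m ^ 2) sequentially" by (simp add: filterlim_at_top_dense)
      with eventually_gt_at_top[of 0] show ?thesis
      proof eventually_elim
        case (elim m)
        have "real (m ^ 12) * (1 / real m ^ 10) = real m ^ 2"
          using elim(1) power_diff[of "real m" 10 12] by simp
        then have "indicator {0..<real (m ^ 12) * (1 / real m ^ 10)} t = (1::real)"
          using True elim(2) by (simp only:) simp
        then show ?case using elim(1) by (simp only: s_def F_eq x_def k_def divide_divide_eq_right) simp
      qed
    qed
    moreover have "(\<lambda>m. exp (- l * x m) * \<Phi> (x m) (k m)) \<longlonglongrightarrow> exp (- l * t) * \<psi> (a * t powr (3/2))"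
      by (intro tendsto_intros x \<Phi>)
    ultimately have "(\<lambda>m. s m t) \<longlonglongrightarrow> exp (- l * t) * \<psi> (a * t powr (3/2))"
      by (rule Lim_transform_eventually[rotated])
    then show ?thesis using True by (simp add: f_def mult.commute)
  qed (simp add: s_def f_def)
  have [measurable]: "s (Suc m) \<in> borel_measurable lborel" for m
    using s[of "Suc m"] by (auto simp: has_bochner_integral_iff)
  have lim': "(\<lambda>m. s (Suc m) t) \<longlonglongrightarrow> f t" for t by (rule LIMSEQ_Suc[OF lim])
  have [measurable]: "f \<in> borel_measurable lborel"
    by (rule borel_measurable_LIMSEQ_real[OF lim']) auto
  \<comment> \<open>Rounding t down to the grid loses at most h <= 1 of time, so the discount at the
    grid time exceeds that at t by at most the factor exp l.\<close>
  have bound_int: "integrable lborel (\<lambda>t. exp l * (indicator {0..} t *\<^sub>R exp (- (l * t))))"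
  proof -
    have "integrable lborel (\<lambda>t::real. indicator {0..} (0 + l * t) *\<^sub>R ((0 + l * t) ^ 0 * exp (- (0 + l * t))))"
      using l has_bochner_integral_power_exp[of 0] by (intro lborel_integrable_real_affine) (auto simp: has_bochner_integral_iff)
    also have "(\<lambda>t::real. indicator {0..} (0 + l * t) *\<^sub>R ((0 + l * t) ^ 0 * exp (- (0 + l * t)))) = (\<lambda>t. indicator {0..} t *\<^sub>R exp (- (l * t)))"
      using l by (auto simp: fun_eq_iff indicator_def zero_le_mult_iff)
    finally show ?thesis by (rule integrable_mult_right)
  qed
  have "(\<lambda>m. integral\<^sup>L lborel (s (Suc m))) \<longlonglongrightarrow> integral\<^sup>L lborel f"
  proof (rule integral_dominated_convergence[OF _ _ bound_int])
    fix m
    show "AE t in lborel. norm (s (Suc m) t) \<le> exp l * (indicator {0..} t *\<^sub>R exp (- (l * t)))"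
    proof (intro AE_I2)
      fix t :: real
      define h where "h = 1 / real (Suc m) ^ 10"
      show "norm (s (Suc m) t) \<le> exp l * (indicator {0..} t *\<^sub>R exp (- (l * t)))"
      proof (cases "t \<ge> 0")
        case True
        have h: "h > 0" "h \<le> 1" by (auto simp: h_def)
        define k where "k = nat \<lfloor>t / h\<rfloor>"
        have "t / h - 1 \<le> real k" unfolding k_def by linarith
        then have "(t / h - 1) * h \<le> real k * h" using h by (intro mult_right_mono) auto
        then have "t - 1 \<le> real k * h" using h by (simp add: left_diff_distrib)
        then have "l * (t - 1) \<le> l * (real k * h)" using l by (intro mult_left_mono) auto
        then have e: "exp (- l * (real k * h)) \<le> exp l * exp (- (l * t))"
          unfolding exp_add[symmetric] by (simp add: algebra_simps)
        have "norm (s (Suc m) t) \<le> \<bar>F (Suc m) k\<bar>"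
          unfolding s_def k_def h_def by (auto simp: indicator_def)
        also have "\<dots> = exp (- l * (real k * h)) * \<bar>\<Phi> (real k * h) k\<bar>"
          using F_eq[of "Suc m" k] by (simp add: h_def abs_mult)
        also have "\<dots> \<le> exp (- l * (real k * h)) * 1"
          using \<Phi>_bound by (intro mult_left_mono) auto
        also have "\<dots> \<le> exp l * exp (- (l * t))" using e by simp
        finally show ?thesis using True by simp
      qed (simp add: s_def)
    qed
  qed (use lim' in auto)
  moreover have "integral\<^sup>L lborel (s (Suc m)) = 1 / real (Suc m) ^ 10 * (\<Sum>k<Suc m ^ 12. F (Suc m) k)" for m
    using s[of "Suc m"] by (simp only: has_bochner_integral_iff)
  ultimately have "(\<lambda>m. 1 / real (Suc m) ^ 10 * (\<Sum>k<Suc m ^ 12. F (Suc m) k)) \<longlonglongrightarrow> integral\<^sup>L lborel f"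
    by (simp only:)
  moreover have "(\<lambda>m. 1 / real (Suc m) ^ 10 * (\<Sum>k<Suc m ^ 12. F (Suc m) k)) \<longlonglongrightarrow> area_fn a l"
    unfolding F_def by (rule LIMSEQ_Suc[OF walk_limit[OF a l]])
  ultimately have "integral\<^sup>L lborel f = area_fn a l" by (rule LIMSEQ_unique)
  then show ?thesis
    unfolding area_fn_eq[OF a l] by (simp add: f_def set_lebesgue_integral_def)
qed

end
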